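(* Let $\mathbb{F}$ be a field, let $k$ be a positive integer, and let $M$ be an $\mathbb{F}$-orientable $(k+1)$-neighbourly $k$-stacked $\mathbb{F}$-homology manifold without boundary, of dimension $d\neq 2k+1$. Then $M$ is $\mathbb{F}$-tight.
   Context: Simplicial complexes are finite and abstract, and contain the empty face. $V(X)$ is the vertex set of $X$. For $A\subseteq V(X)$, $X[A]=\{\alpha\in X:\alpha\subseteq A\}$ is the induced subcomplex on $A$. For a complex $X$ and $0\le j\le \dim X$, $\mathrm{Skel}_j(X)=\{\alpha\in X:\dim\alpha\le j\}$. Homology manifolds (standard definitions): the link of a face $\alpha$ of $X$ is $\{\gamma\in X:\gamma\cap\alpha=\emptyset,\ \gamma\cup\alpha\in X\}$. An $\mathbb{F}$-homology $n$-manifold without boundary is a pure $n$-dimensional complex in which the link of every nonempty face $\alpha$ has the reduced $\mathbb{F}$-homology of a sphere of dimension $n-\#\alpha$. A connected $\mathbb{F}$-homology $n$-manifold $M$ without boundary is $\mathbb{F}$-orientable if $H_n(M;\mathbb{F})\cong\mathbb{F}$. An $\mathbb{F}$-homology $n$-manifold with boundary is a pure $n$-dimensional complex $\Delta$ in which the link of every nonempty face $\alpha$ has either the reduced $\mathbb{F}$-homology of a sphere of dimension $n-\#\alpha$ or trivial reduced $\mathbb{F}$-homology, and such that the boundary $\partial\Delta$, consisting of the empty face and the nonempty faces whose link has trivial reduced homology, is a (nonempty) $\mathbb{F}$-homology $(n-1)$-manifold without boundary. $k$-stacked: an $\mathbb{F}$-homology manifold $\Delta$ with boundary of dimension $d+1$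 is $k$-stacked (where $1\le k\le d$) if $\mathrm{Skel}_{d-k}(\Delta)=\mathrm{Skel}_{d-k}(\partial\Delta)$. An $\mathbb{F}$-homology manifold without boundary of dimension $d$ is $k$-stacked if it equals $\partial\Delta$ for some $k$-stacked $\mathbb{F}$-homology manifold $\Delta$ with boundary of dimension $d+1$. $(k+1)$-neighbourly: any $k+1$ vertices of $X$ form a face of $X$ (for $k\geq 1$ such a complex is connected). $\mathbb{F}$-tight: $X$ is connected and, for every induced subcomplex $Y$ of $X$, the $\mathbb{F}$-linear map $H_*(Y;\mathbb{F})\to H_*(X;\mathbb{F})$ induced by inclusion is injective in all degrees. *)

theory Defs
  imports Main "HOL-Library.Function_Algebras"
begin

section \<open>Simplicial complexes\<close>

definition simplicial_complex :: "'v set set \<Rightarrow> bool" where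
  "simplicial_complex X \<longleftrightarrow>
     finite X \<and> {} \<in> X \<and> (\<forall>\<alpha>\<in>X. finite \<alpha>) \<and> (\<forall>\<alpha>\<in>X. \<forall>\<beta>. \<beta> \<subseteq> \<alpha> \<longrightarrow> \<beta> \<in> X)"

definition vertices :: "'v set set \<Rightarrow> 'v set" where
  "vertices X = \<Union>X"

definition face_dim :: "'v set \<Rightarrow> int" where
  "face_dim \<alpha> = int (card \<alpha>) - 1"

definition induced_subcomplex :: "'v set set \<Rightarrow> 'v set \<Rightarrow> 'v set set" where
  "induced_subcomplex X A = {\<alpha> \<in> X. \<alpha> \<subseteq> A}"

definition skel :: "int \<Rightarrow> 'v set set \<Rightarrow> 'v set set" where
  "skel j X = {\<alpha> \<in> X. face_dim \<alpha> \<le> j}"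

definition link :: "'v set set \<Rightarrow> 'v set \<Rightarrow> 'v set set" where
  "link X \<alpha> = {\<gamma> \<in> X. \<gamma> \<inter> \<alpha> = {} \<and> \<gamma> \<union> \<alpha> \<in> X}"

definition pure_dim :: "int \<Rightarrow> 'v set set \<Rightarrow> bool" where
  "pure_dim n X \<longleftrightarrow> (\<forall>\<alpha>\<in>X. (\<forall>\<beta>\<in>X. \<alpha> \<subseteq> \<beta> \<longrightarrow> \<beta> = \<alpha>) \<longrightarrow> face_dim \<alpha> = n)"

definition connected_complex :: "'v set set \<Rightarrow> bool" where
  "connected_complex X \<longleftrightarrow>
     (\<forall>u\<in>vertices X. \<forall>v\<in>vertices X. (u, v) \<in> {(a, b). {a, b} \<in> X}\<^sup>*)"

definition neighbourly :: "int \<Rightarrow> 'v set set \<Rightarrow> bool" where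
  "neighbourly m X \<longleftrightarrow> (\<forall>A \<subseteq> vertices X. int (card A) = m \<longrightarrow> A \<in> X)"


section \<open>Simplicial homology with coefficients in a field\<close>

text \<open>
  Faces are oriented by one fixed, arbitrarily chosen linear order on the vertex type.

  The constants below take a set \<open>K\<close> of faces, which is used in two ways.  For a complex \<open>X\<close>,
  \<open>K = X\<close> gives the augmented chain complex (the empty face spans degree \<open>-1\<close>), hence reduced
  homology; \<open>K = X - {{}}\<close> gives the ordinary chain complex, hence ordinary homology.
  A chain is a function on faces, its value at a face being the coefficient of that face.
\<close>

definition vertex_order :: "'v rel" where
  "vertex_order = (SOME r. linear_order r)"

lemma linear_order_vertex_order: "linear_order (vertex_order :: 'v rel)"
proof -
  obtain r :: "'v rel" where "well_order_on UNIV r"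
    using well_order_on by blast
  then have "linear_order r"
    by (simp add: well_order_on_def)
  then show ?thesis
    unfolding vertex_order_def by (rule someI[of linear_order r])
qed

definition chain_space :: "'v set set \<Rightarrow> int \<Rightarrow> ('v set \<Rightarrow> 'f::field) set" where
  "chain_space K j = {c. \<forall>\<sigma>. c \<sigma> \<noteq> 0 \<longrightarrow> \<sigma> \<in> K \<and> face_dim \<sigma> = j}"

text \<open>
  This is the usual \<open>\<partial>[v\<^sub>0,\<dots>,v\<^sub>j] = (\<Sum>i\<le>j. (-1)^i [v\<^sub>0,\<dots>,v\<^sub>i\<^sub>-\<^sub>1,v\<^sub>i\<^sub>+\<^sub>1,\<dots>,v\<^sub>j])\<close> for
  increasing vertices: the coefficient of \<open>\<tau>\<close> collects one term for every face
  \<open>insert v \<tau>\<close>, and the number of \<open>u \<in> \<tau>\<close> below \<open>v\<close> is the position of \<open>v\<close> in that face.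
\<close>

definition chain_boundary ::
  "'v set set \<Rightarrow> ('v set \<Rightarrow> 'f::field) \<Rightarrow> ('v set \<Rightarrow> 'f)" where
  "chain_boundary K c =
     (\<lambda>\<tau>. if \<tau> \<in> K
          then (\<Sum>v | v \<notin> \<tau> \<and> insert v \<tau> \<in> K.
                  (-1) ^ card {u \<in> \<tau>. (u, v) \<in> vertex_order} * c (insert v \<tau>))
          else 0)"

definition cycle_space :: "'v set set \<Rightarrow> int \<Rightarrow> ('v set \<Rightarrow> 'f::field) set" where
  "cycle_space K j = {c \<in> chain_space K j. chain_boundary K c = 0}"

definition boundary_space :: "'v set set \<Rightarrow> int \<Rightarrow> ('v set \<Rightarrow> 'f::field) set" where
  "boundary_space K j = chain_boundary K ` chain_space K (j + 1)"

definition homology_class ::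
  "'v set set \<Rightarrow> int \<Rightarrow> ('v set \<Rightarrow> 'f::field) \<Rightarrow> ('v set \<Rightarrow> 'f) set" where
  "homology_class K j z = (\<lambda>b. z + b) ` boundary_space K j"

text \<open>The quotient space of cycles modulo boundaries, as a set of cosets.\<close>

definition homology_space :: "'v set set \<Rightarrow> int \<Rightarrow> ('v set \<Rightarrow> 'f::field) set set" where
  "homology_space K j = homology_class K j ` cycle_space K j"

text \<open>
  A linear isomorphism of the quotient space with the field, the vector space operations on
  cosets being given by representatives.
\<close>

definition homology_iso_field :: "'f::field itself \<Rightarrow> 'v set set \<Rightarrow> int \<Rightarrow> bool" where
  "homology_iso_field F K j \<longleftrightarrow>
     (\<exists>\<phi> :: ('v set \<Rightarrow> 'f) set \<Rightarrow> 'f.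
        bij_betw \<phi> (homology_space K j) UNIV \<and>
        (\<forall>z\<in>cycle_space K j. \<forall>w\<in>cycle_space K j.
           \<phi> (homology_class K j (z + w)) = \<phi> (homology_class K j z) + \<phi> (homology_class K j w)) \<and>
        (\<forall>a. \<forall>z\<in>cycle_space K j.
           \<phi> (homology_class K j (\<lambda>\<sigma>. a * z \<sigma>)) = a * \<phi> (homology_class K j z)))"

definition homology_trivial :: "'f::field itself \<Rightarrow> 'v set set \<Rightarrow> int \<Rightarrow> bool" where
  "homology_trivial F K j \<longleftrightarrow>
     (homology_space K j :: ('v set \<Rightarrow> 'f) set set) = {homology_class K j 0}"

text \<open>
  The map on homology induced by the inclusion into \<open>L\<close> of a subcomplex (with or without the
  empty face, in accordance with \<open>L\<close>).  On chains the inclusion is the identity, and all elements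
  of a coset modulo the boundaries of the subcomplex have the same class modulo the boundaries
  of \<open>L\<close>, so \<open>the_elem\<close> is applied to a singleton.
\<close>

definition homology_inclusion ::
  "'v set set \<Rightarrow> int \<Rightarrow> ('v set \<Rightarrow> 'f::field) set \<Rightarrow> ('v set \<Rightarrow> 'f) set" where
  "homology_inclusion L j C = the_elem (homology_class L j ` C)"

definition sphere_reduced_homology :: "'f::field itself \<Rightarrow> int \<Rightarrow> 'v set set \<Rightarrow> bool" where
  "sphere_reduced_homology F m X \<longleftrightarrow>
     (\<forall>j. if j = m then homology_iso_field F X j else homology_trivial F X j)"

definition trivial_reduced_homology :: "'f::field itself \<Rightarrow> 'v set set \<Rightarrow> bool" where
  "trivial_reduced_homology F X \<longleftrightarrow> (\<forall>j. homology_trivial F X j)"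


section \<open>Homology manifolds\<close>

definition homology_manifold :: "'f::field itself \<Rightarrow> int \<Rightarrow> 'v set set \<Rightarrow> bool" where
  "homology_manifold F n X \<longleftrightarrow>
     simplicial_complex X \<and> pure_dim n X \<and>
     (\<forall>\<alpha>\<in>X. \<alpha> \<noteq> {} \<longrightarrow> sphere_reduced_homology F (n - int (card \<alpha>)) (link X \<alpha>))"

definition orientable :: "'f::field itself \<Rightarrow> int \<Rightarrow> 'v set set \<Rightarrow> bool" where
  "orientable F n M \<longleftrightarrow>
     connected_complex M \<and> homology_manifold F n M \<and> homology_iso_field F (M - {{}}) n"

definition manifold_boundary :: "'f::field itself \<Rightarrow> 'v set set \<Rightarrow> 'v set set" where
  "manifold_boundary F X =
     insert {} {\<alpha> \<in> X. \<alpha> \<noteq> {} \<and> trivial_reduced_homology F (link X \<alpha>)}"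

text \<open>A nonempty boundary is one having a face other than the empty one.\<close>

definition homology_manifold_with_boundary :: "'f::field itself \<Rightarrow> int \<Rightarrow> 'v set set \<Rightarrow> bool" where
  "homology_manifold_with_boundary F n X \<longleftrightarrow>
     simplicial_complex X \<and> pure_dim n X \<and>
     (\<forall>\<alpha>\<in>X. \<alpha> \<noteq> {} \<longrightarrow>
        sphere_reduced_homology F (n - int (card \<alpha>)) (link X \<alpha>) \<or>
        trivial_reduced_homology F (link X \<alpha>)) \<and>
     manifold_boundary F X \<noteq> {{}} \<and>
     homology_manifold F (n - 1) (manifold_boundary F X)"

text \<open>Here \<open>d + 1\<close> is the dimension of \<open>X\<close>.\<close>

definition stacked_with_boundary :: "'f::field itself \<Rightarrow> int \<Rightarrow> int \<Rightarrow> 'v set set \<Rightarrow> bool" where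
  "stacked_with_boundary F k d X \<longleftrightarrow>
     homology_manifold_with_boundary F (d + 1) X \<and> 1 \<le> k \<and> k \<le> d \<and>
     skel (d - k) X = skel (d - k) (manifold_boundary F X)"

text \<open>
  Taking \<open>X\<close> over the vertex type of \<open>M\<close> is no restriction: as \<open>d - k \<ge> 0\<close>, every vertex of a
  \<open>k\<close>-stacked \<open>X\<close> is a vertex of its boundary.
\<close>

definition stacked :: "'f::field itself \<Rightarrow> int \<Rightarrow> int \<Rightarrow> 'v set set \<Rightarrow> bool" where
  "stacked F k d M \<longleftrightarrow>
     homology_manifold F d M \<and>
     (\<exists>X :: 'v set set. stacked_with_boundary F k d X \<and> M = manifold_boundary F X)"


section \<open>Tightness\<close>

definition tight :: "'f::field itself \<Rightarrow> 'v set set \<Rightarrow> bool" where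
  "tight F X \<longleftrightarrow>
     connected_complex X \<and>
     (\<forall>A \<subseteq> vertices X. \<forall>j.
        inj_on (homology_inclusion (X - {{}}) j)
          (homology_space (induced_subcomplex X A - {{}}) j :: ('v set \<Rightarrow> 'f) set set))"

end

theory Submission imports Defs begin

text \<open>
  Let \<open>M\<close> be the boundary of the \<open>k\<close>-stacked manifold \<open>X\<close> of dimension \<open>d + 1\<close>, and let \<open>A\<close> be a set
  of vertices.  Tightness says that a chain of \<open>M[A]\<close> of degree \<open>j \<ge> 0\<close> which bounds in \<open>M\<close> already
  bounds in \<open>M[A]\<close>.  There are three ranges of degrees.

  Low degrees, \<open>j \<le> k - 1\<close>.  All sets of at most \<open>k + 1\<close> vertices are faces, so the cone over the
  cycle with apex a vertex of \<open>A\<close> stays in \<open>M[A]\<close> (lemma \<open>low_degree_cycle_bounds\<close>).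

  The other two ranges rest on one elementary step, which takes the place of duality.  Suppose that
  a chain of \<open>K[A]\<close> is the boundary of a chain \<open>c\<close> of \<open>K[A \<union> {v}]\<close>.  The faces of \<open>c\<close> containing \<open>v\<close> form
  the cone over a cycle of \<open>lk(v)[A]\<close>; if this cycle bounds in \<open>lk(v)[A]\<close>, the cone can be
  replaced, and \<open>v\<close> disappears from \<open>c\<close> (lemma \<open>boundary_delete_vertex\<close>).  Deleting the vertices
  outside \<open>A\<close> one by one reduces a statement on induced subcomplexes of \<open>K\<close> to the same statement for
  the links of its vertices.  Since the link of \<open>v\<close> in \<open>lk(\<alpha>)\<close> is \<open>lk(\<alpha> \<union> {v})\<close>, both ranges
  are settled by descending induction on the number of vertices of a face \<open>\<alpha>\<close>.

  Middle degrees, \<open>k \<le> j \<le> d - k - 1\<close>.  In \<open>X\<close> every nonempty face of dimension at most \<open>d - k\<close> is a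
  boundary face and so has an acyclic link.  Hence all cycles met in the induction bound in the
  whole link, until \<open>\<alpha>\<close> has dimension \<open>d - k\<close>; then the link has dimension at most \<open>k\<close> and no chains of degree
  \<open>j + 1\<close> (lemma \<open>boundary_restricts_high_degree_stacked\<close>).  So a chain of \<open>M[A]\<close> bounding in \<open>M\<close>
  bounds in \<open>X[A]\<close>, and therefore in \<open>M[A]\<close>, because \<open>X\<close> and \<open>M\<close> have the same faces of dimension
  \<open>j + 1 \<le> d - k\<close>.

  High degrees, \<open>j \<ge> d - k\<close>.  The same induction runs inside \<open>M\<close>, over faces with at most \<open>k + 1\<close>
  vertices.  If there are \<open>k + 1\<close>, the link has dimension below \<open>d - k\<close>; if there are fewer,
  neighbourliness makes every other vertex a vertex of the link.  Now the links are homology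
  spheres, and what obstructs the deletion of vertices is a fundamental cycle.  It obstructs only
  the first deletion, where it is removed by subtracting a multiple of the fundamental cycle of the
  complex one dimension up.  This uses that a nonzero top-dimensional cycle involves every vertex
  (lemma \<open>top_cycle_meets_every_vertex\<close>), and, for \<open>M\<close> itself, orientability.
\<close>

section \<open>The boundary operator and a vertex\<close>

definition incidence :: "'v set \<Rightarrow> 'v \<Rightarrow> 'f::field" where
  "incidence \<tau> v = (-1) ^ card {u \<in> \<tau>. (u, v) \<in> vertex_order}"

text \<open>
  The augmented boundary operator of the full simplex on \<open>W\<close>.  On chains of a complex with
  vertices in \<open>W\<close> it agrees with the operator of the complex, so chains of different
  subcomplexes and links can be compared without reference to any of them.
\<close>

definition bd :: "'v set \<Rightarrow> ('v set \<Rightarrow> 'f::field) \<Rightarrow> ('v set \<Rightarrow> 'f)" where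
  "bd W c = (\<lambda>\<tau>. \<Sum>v\<in>W - \<tau>. incidence \<tau> v * c (insert v \<tau>))"

text \<open>
  The contraction of a chain along \<open>v\<close>: up to the term \<open>avoiding v c\<close>, the chain \<open>c\<close> is the cone
  with apex \<open>v\<close> over \<open>link_part v c\<close>.  The sign makes this true for cones whose apex need not be the
  least vertex.
\<close>

definition link_part :: "'v \<Rightarrow> ('v set \<Rightarrow> 'f::field) \<Rightarrow> ('v set \<Rightarrow> 'f)" where
  "link_part v c = (\<lambda>\<tau>. if v \<in> \<tau> then 0 else incidence \<tau> v * c (insert v \<tau>))"

definition avoiding :: "'v \<Rightarrow> ('v set \<Rightarrow> 'f::field) \<Rightarrow> ('v set \<Rightarrow> 'f)" where
  "avoiding v c = (\<lambda>\<tau>. if v \<in> \<tau> then 0 else c \<tau>)"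

lemma incidence_nonzero [simp]: "incidence \<tau> v \<noteq> 0"
  by (simp add: incidence_def)

lemma incidence_square [simp]: "incidence \<tau> v * (incidence \<tau> v * x) = x"
  by (simp add: incidence_def mult.assoc[symmetric] power_add[symmetric] mult_2[symmetric])

lemma incidence_insert:
  assumes "finite \<tau>" "u \<notin> \<tau>"
  shows "incidence (insert u \<tau>) v = (if (u, v) \<in> vertex_order then - incidence \<tau> v else incidence \<tau> v)"
proof -
  have "{x \<in> insert u \<tau>. (x, v) \<in> vertex_order} =
    (if (u, v) \<in> vertex_order then insert u {x \<in> \<tau>. (x, v) \<in> vertex_order}
     else {x \<in> \<tau>. (x, v) \<in> vertex_order})" by auto
  then show ?thesis using assms by (simp add: incidence_def)
qed

text \<open>
  Deleting two vertices in either order gives opposite signs: exactly one of the two precedes the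
  other, so exactly one of the two positions is shifted.
\<close>

lemma incidence_swap:
  assumes "finite \<tau>" "u \<notin> \<tau>" "v \<notin> \<tau>" "u \<noteq> v"
  shows "incidence \<tau> v * incidence (insert v \<tau>) u = - (incidence \<tau> u * incidence (insert u \<tau>) v)"
proof -
  have "(u, v) \<in> vertex_order \<longleftrightarrow> (v, u) \<notin> vertex_order"
    using linear_order_vertex_order assms(4)
    by (auto simp: linear_order_on_def partial_order_on_def total_on_def antisym_def)
  then show ?thesis using assms by (auto simp: incidence_insert)
qed

lemma bd_zero: "bd W 0 = 0"
  by (auto simp: bd_def fun_eq_iff)

lemma bd_support: "bd W c \<sigma> \<noteq> 0 \<Longrightarrow> \<exists>v\<in>W - \<sigma>. c (insert v \<sigma>) \<noteq> 0"
  unfolding bd_def by (metis (no_types, lifting) mult_zero_right sum.neutral)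

lemma bd_add: "bd W (a + b) = bd W a + bd W b"
  by (auto simp: bd_def fun_eq_iff distrib_left sum.distrib)

lemma bd_scale: "bd W (\<lambda>\<sigma>. a * c \<sigma>) = (\<lambda>\<sigma>. a * bd W c \<sigma>)"
  by (auto simp: bd_def fun_eq_iff sum_distrib_left mult.left_commute)

lemma bd_diff: "bd W (a - b) = bd W a - bd W b"
  by (auto simp: bd_def fun_eq_iff right_diff_distrib sum_subtractf)

lemma bd_uminus: "bd W (- b) = - bd W b"
  by (auto simp: bd_def fun_eq_iff sum_negf)

text \<open>
  Together with \<open>avoiding_bd\<close> this splits the boundary of \<open>c = c' + v * e\<close>, with \<open>v\<close> not in \<open>c'\<close>
  and \<open>e\<close>, into \<open>(bd c' + e) - v * bd e\<close>.  These two identities are all that is used about signs.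
\<close>

lemma link_part_bd:
  assumes W: "finite W" "v \<in> W" and c: "\<And>\<sigma>. c \<sigma> \<noteq> 0 \<Longrightarrow> \<sigma> \<subseteq> W"
  shows "link_part v (bd W c) = - bd W (link_part v c)"
proof
  fix \<tau>
  show "link_part v (bd W c) \<tau> = (- bd W (link_part v c)) \<tau>"
  proof (cases "v \<in> \<tau> \<or> infinite \<tau>")
    case True
    moreover have "c \<sigma> = 0" if "infinite \<sigma>" for \<sigma>
      using c that W(1) by (meson finite_subset)
    ultimately show ?thesis by (auto simp: link_part_def bd_def sum.neutral)
  next
    case False
    have "(\<Sum>u\<in>W - \<tau>. incidence \<tau> u * link_part v c (insert u \<tau>)) =
          (\<Sum>u\<in>W - insert v \<tau>. incidence \<tau> u * link_part v c (insert u \<tau>))"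
      using W by (intro sum.mono_neutral_right) (auto simp: link_part_def)
    also have "\<dots> = (\<Sum>u\<in>W - insert v \<tau>.
        - (incidence \<tau> v * incidence (insert v \<tau>) u * c (insert u (insert v \<tau>))))"
      using False by (intro sum.cong) (auto simp: link_part_def incidence_swap[of \<tau> _ v] insert_commute)
    finally show ?thesis
      using False by (simp add: link_part_def bd_def sum_negf sum_distrib_left mult.assoc)
  qed
qed

lemma avoiding_bd:
  assumes W: "finite W" "v \<in> W"
  shows "avoiding v (bd W c) = bd W (avoiding v c) + link_part v c"
proof
  fix \<tau>
  show "avoiding v (bd W c) \<tau> = (bd W (avoiding v c) + link_part v c) \<tau>"
  proof (cases "v \<in> \<tau>")
    case True
    then show ?thesis by (auto simp: link_part_def avoiding_def bd_def)
  next
    case False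
    have "bd W (avoiding v c) \<tau> = (\<Sum>u\<in>W - insert v \<tau>. incidence \<tau> u * avoiding v c (insert u \<tau>))"
      unfolding bd_def using W by (intro sum.mono_neutral_right) (auto simp: avoiding_def)
    also have "\<dots> = (\<Sum>u\<in>W - insert v \<tau>. incidence \<tau> u * c (insert u \<tau>))"
      using False by (intro sum.cong) (auto simp: avoiding_def)
    finally have a: "bd W (avoiding v c) \<tau> = (\<Sum>u\<in>W - insert v \<tau>. incidence \<tau> u * c (insert u \<tau>))" .
    have "W - \<tau> = insert v (W - insert v \<tau>)" using W False by auto
    then have "bd W c \<tau> = (\<Sum>u\<in>insert v (W - insert v \<tau>). incidence \<tau> u * c (insert u \<tau>))"
      unfolding bd_def by metis
    also have "\<dots> = incidence \<tau> v * c (insert v \<tau>) + bd W (avoiding v c) \<tau>"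
      unfolding a using W by (subst sum.insert) auto
    finally show ?thesis using False by (simp add: avoiding_def[of v "bd W c"] link_part_def)
  qed
qed

lemma chain_eqI:
  assumes "avoiding v a = avoiding v b" "link_part v a = link_part v b"
  shows "a = b"
proof
  fix \<sigma>
  show "a \<sigma> = b \<sigma>"
  proof (cases "v \<in> \<sigma>")
    case True
    have "link_part v a (\<sigma> - {v}) = link_part v b (\<sigma> - {v})" using assms by simp
    then show ?thesis using True by (simp add: link_part_def insert_absorb)
  next
    case False
    then show ?thesis using fun_cong[OF assms(1), of \<sigma>] by (simp add: avoiding_def)
  qed
qed

lemma link_part_support: "link_part v c \<sigma> \<noteq> 0 \<Longrightarrow> c (insert v \<sigma>) \<noteq> 0 \<and> v \<notin> \<sigma>"
  by (auto simp: link_part_def split: if_splits)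

lemma avoiding_support: "avoiding v c \<sigma> \<noteq> 0 \<Longrightarrow> c \<sigma> \<noteq> 0 \<and> v \<notin> \<sigma>"
  by (auto simp: avoiding_def split: if_splits)

text \<open>
  Both parts of \<open>bd (bd c)\<close> at a vertex \<open>v\<close> reduce to iterated boundaries of chains not involving
  \<open>v\<close>, so induction on the set of vertices works and no double sum over pairs, which would
  need care in characteristic two, appears.
\<close>

lemma bd_bd:
  fixes c :: "'v set \<Rightarrow> 'f::field"
  assumes W: "finite W" and c: "\<And>\<sigma>. c \<sigma> \<noteq> 0 \<Longrightarrow> \<sigma> \<subseteq> W"
  shows "bd W (bd W c) = 0"
proof -
  have "bd W (bd W c) = 0" if "finite T" "T \<subseteq> W" "\<And>\<sigma>. c \<sigma> \<noteq> 0 \<Longrightarrow> \<sigma> \<subseteq> T" for T and c :: "'v set \<Rightarrow> 'f::field"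
    using that
  proof (induction T arbitrary: c rule: finite_induct)
    case empty
    then have "c (insert u \<tau>) = 0" for u \<tau> by blast
    then have "bd W c = 0" using bd_support by (metis ext zero_fun_apply)
    then show ?case by (simp only: bd_zero)
  next
    case (insert v T)
    have v: "v \<in> W" using insert.prems by blast
    have cW: "\<sigma> \<subseteq> W" if "c \<sigma> \<noteq> 0" for \<sigma>
      using insert.prems that by blast
    have bW: "\<sigma> \<subseteq> W" if "bd W c \<sigma> \<noteq> 0" for \<sigma>
      using bd_support[OF that] cW by blast
    have l: "bd W (bd W (link_part v c)) = 0"
      using insert.prems by (intro insert.IH) (blast dest: link_part_support)+
    have a: "bd W (bd W (avoiding v c)) = 0"
      using insert.prems by (intro insert.IH) (blast dest: avoiding_support)+
    have lc: "link_part v (bd W c) = - bd W (link_part v c)"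
      by (rule link_part_bd[OF W v cW])
    have lbc: "link_part v (bd W (bd W c)) = - bd W (link_part v (bd W c))"
      by (rule link_part_bd[OF W v bW])
    show ?case
    proof (rule chain_eqI[of v])
      have "avoiding v (bd W (bd W c)) =
          bd W (bd W (avoiding v c) + link_part v c) + - bd W (link_part v c)"
        by (simp only: avoiding_bd[OF W v] lc)
      also have "\<dots> = 0" by (simp only: bd_add a add_0 add.right_inverse)
      also have "0 = avoiding v 0" by (auto simp: avoiding_def)
      finally show "avoiding v (bd W (bd W c)) = avoiding v 0" .
      have "link_part v (bd W (bd W c)) = - bd W (- bd W (link_part v c))"
        by (simp only: lbc lc)
      also have "\<dots> = 0" by (simp only: bd_uminus l minus_zero)
      also have "0 = link_part v 0" by (auto simp: link_part_def)
      finally show "link_part v (bd W (bd W c)) = link_part v 0" .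
    qed
  qed
  from this[OF W subset_refl c] show ?thesis .
qed


section \<open>Chains of simplicial complexes\<close>

lemma complex_subset: "simplicial_complex K \<Longrightarrow> \<sigma> \<in> K \<Longrightarrow> \<tau> \<subseteq> \<sigma> \<Longrightarrow> \<tau> \<in> K"
  by (auto simp: simplicial_complex_def)

lemma complex_finite: "simplicial_complex K \<Longrightarrow> \<sigma> \<in> K \<Longrightarrow> finite \<sigma>"
  by (auto simp: simplicial_complex_def)

lemma finite_vertices: "simplicial_complex K \<Longrightarrow> finite (vertices K)"
  by (auto simp: simplicial_complex_def vertices_def)

lemma complex_Pow_vertices: "K \<subseteq> Pow (vertices K)"
  by (auto simp: vertices_def)

lemma vertices_iff: "simplicial_complex K \<Longrightarrow> v \<in> vertices K \<longleftrightarrow> {v} \<in> K"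
  by (auto simp: vertices_def intro: complex_subset)

lemma complex_induced: "simplicial_complex K \<Longrightarrow> simplicial_complex (induced_subcomplex K A)"
  by (auto simp: simplicial_complex_def induced_subcomplex_def)

lemma complex_link:
  assumes "simplicial_complex K" "\<alpha> \<in> K"
  shows "simplicial_complex (link K \<alpha>)"
proof -
  have "\<beta> \<in> link K \<alpha>" if "\<gamma> \<in> link K \<alpha>" "\<beta> \<subseteq> \<gamma>" for \<beta> \<gamma>
    using that complex_subset[OF assms(1), of \<gamma> \<beta>] complex_subset[OF assms(1), of "\<gamma> \<union> \<alpha>" "\<beta> \<union> \<alpha>"]
    by (auto simp: link_def)
  moreover have "finite (link K \<alpha>)" "{} \<in> link K \<alpha>" "\<forall>\<gamma>\<in>link K \<alpha>. finite \<gamma>"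
    using assms by (auto simp: simplicial_complex_def link_def)
  ultimately show ?thesis unfolding simplicial_complex_def by blast
qed

lemma link_subset: "link K \<alpha> \<subseteq> K"
  by (auto simp: link_def)

lemma link_empty: "link K {} = K"
  by (auto simp: link_def)

lemma induced_subset: "induced_subcomplex K A \<subseteq> K"
  by (auto simp: induced_subcomplex_def)

lemma induced_all: "K \<subseteq> Pow W \<Longrightarrow> induced_subcomplex K W = K"
  by (auto simp: induced_subcomplex_def)

lemma vertex_in_link:
  "simplicial_complex K \<Longrightarrow> {v} \<in> link K \<alpha> \<longleftrightarrow> v \<notin> \<alpha> \<and> insert v \<alpha> \<in> K"
  by (auto simp: link_def intro: complex_subset)

lemma link_link: "v \<notin> \<alpha> \<Longrightarrow> simplicial_complex K \<Longrightarrow> link (link K \<alpha>) {v} = link K (insert v \<alpha>)"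
  by (auto simp: link_def intro: complex_subset)

lemma face_dim_insert: "finite \<sigma> \<Longrightarrow> v \<notin> \<sigma> \<Longrightarrow> face_dim (insert v \<sigma>) = face_dim \<sigma> + 1"
  by (simp add: face_dim_def)

lemma chain_space_zero: "0 \<in> chain_space K j"
  by (simp add: chain_space_def)

lemma chain_space_add: "a \<in> chain_space K j \<Longrightarrow> b \<in> chain_space K j \<Longrightarrow> a + b \<in> chain_space K j"
  unfolding chain_space_def by (simp, metis add_0)

lemma chain_space_diff: "a \<in> chain_space K j \<Longrightarrow> b \<in> chain_space K j \<Longrightarrow> a - b \<in> chain_space K j"
  unfolding chain_space_def by (simp, metis diff_self)

lemma chain_space_scale: "b \<in> chain_space K j \<Longrightarrow> (\<lambda>\<sigma>. a * b \<sigma>) \<in> chain_space K j"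
  by (fastforce simp: chain_space_def)

lemma chain_space_mono: "K \<subseteq> L \<Longrightarrow> c \<in> chain_space K j \<Longrightarrow> c \<in> chain_space L j"
  by (auto simp: chain_space_def)

lemma chain_space_support: "c \<in> chain_space K j \<Longrightarrow> K \<subseteq> Pow W \<Longrightarrow> c \<sigma> \<noteq> 0 \<Longrightarrow> \<sigma> \<subseteq> W"
  by (auto simp: chain_space_def)

lemma chain_space_no_faces:
  "(\<And>\<sigma>. \<sigma> \<in> K \<Longrightarrow> face_dim \<sigma> \<noteq> j) \<Longrightarrow> c \<in> chain_space K j \<Longrightarrow> c = 0"
  by (auto simp: chain_space_def fun_eq_iff)

text \<open>
  Only faces of dimension \<open>j\<close> need to have their facets in \<open>K\<close>.  Thus the lemma covers both the
  augmented complex and, for \<open>j \<ge> 1\<close>, the complex without the empty face.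
\<close>

lemma chain_boundary_bd:
  assumes W: "finite W" "K \<subseteq> Pow W" and c: "c \<in> chain_space K j"
    and closed: "\<And>v \<tau>. insert v \<tau> \<in> K \<Longrightarrow> v \<notin> \<tau> \<Longrightarrow> face_dim (insert v \<tau>) = j \<Longrightarrow> \<tau> \<in> K"
  shows "chain_boundary K c = bd W c"
proof
  fix \<tau>
  show "chain_boundary K c \<tau> = bd W c \<tau>"
  proof (cases "\<tau> \<in> K")
    case True
    have "(\<Sum>v | v \<notin> \<tau> \<and> insert v \<tau> \<in> K. incidence \<tau> v * c (insert v \<tau>)) = bd W c \<tau>"
      unfolding bd_def using W c by (intro sum.mono_neutral_left) (auto simp: chain_space_def)
    with True show ?thesis by (simp add: chain_boundary_def incidence_def)
  next
    case False
    then have "c (insert v \<tau>) = 0" if "v \<notin> \<tau>" for v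
      using closed c that by (auto simp: chain_space_def)
    then have "bd W c \<tau> = 0" using bd_support by (metis DiffD2)
    with False show ?thesis by (simp add: chain_boundary_def)
  qed
qed

lemma complex_chain_boundary:
  assumes "simplicial_complex K" "finite W" "K \<subseteq> Pow W" "c \<in> chain_space K j"
  shows "chain_boundary K c = bd W c"
  using assms by (intro chain_boundary_bd) (auto intro: complex_subset)

lemma cycle_space_bd:
  assumes "simplicial_complex K" "finite W" "K \<subseteq> Pow W"
  shows "z \<in> cycle_space K j \<longleftrightarrow> z \<in> chain_space K j \<and> bd W z = 0"
  using complex_chain_boundary[OF assms, of z j] unfolding cycle_space_def by auto

lemma boundary_space_bd:
  assumes "simplicial_complex K" "finite W" "K \<subseteq> Pow W"
  shows "z \<in> boundary_space K j \<longleftrightarrow> (\<exists>c\<in>chain_space K (j + 1). bd W c = z)"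
  using complex_chain_boundary[OF assms] by (force simp: boundary_space_def)

lemma boundary_space_zero:
  assumes "simplicial_complex K"
  shows "0 \<in> boundary_space K j"
  unfolding boundary_space_bd[OF assms finite_vertices[OF assms] complex_Pow_vertices]
  using chain_space_zero bd_zero by blast

lemma cycle_space_mono:
  assumes "simplicial_complex L" "simplicial_complex K" "K \<subseteq> L" "z \<in> cycle_space K j"
  shows "z \<in> cycle_space L j"
proof -
  have "K \<subseteq> Pow (vertices L)" using assms(3) complex_Pow_vertices by blast
  then show ?thesis
    using assms cycle_space_bd[OF _ finite_vertices[OF assms(1)], of K]
      cycle_space_bd[OF _ finite_vertices[OF assms(1)] complex_Pow_vertices] chain_space_mono by metis
qed

lemma boundary_space_mono:
  assumes "simplicial_complex L" "simplicial_complex K" "K \<subseteq> L" "z \<in> boundary_space K j"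
  shows "z \<in> boundary_space L j"
proof -
  have "K \<subseteq> Pow (vertices L)" using assms(3) complex_Pow_vertices by blast
  then show ?thesis
    using assms boundary_space_bd[OF _ finite_vertices[OF assms(1)], of K]
      boundary_space_bd[OF _ finite_vertices[OF assms(1)] complex_Pow_vertices] chain_space_mono by metis
qed

lemma boundary_is_cycle:
  assumes K: "simplicial_complex K" and z: "z \<in> chain_space K j" "z \<in> boundary_space K j"
  shows "z \<in> cycle_space K j"
proof -
  note W = finite_vertices[OF K] complex_Pow_vertices[of K]
  obtain c where "c \<in> chain_space K (j + 1)" "bd (vertices K) c = z"
    using z(2) boundary_space_bd[OF K W] by blast
  then have "bd (vertices K) z = 0"
    using bd_bd[OF W(1)] chain_space_support[OF _ W(2)] by metis
  then show ?thesis using z cycle_space_bd[OF K W] by blast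
qed

lemma trivial_homology_cycle_bounds:
  assumes "homology_trivial TYPE('f::field) K j" "simplicial_complex K"
    and z: "(z :: 'v set \<Rightarrow> 'f) \<in> cycle_space K j"
  shows "z \<in> boundary_space K j"
proof -
  have "homology_class K j z = homology_class K j 0"
    using assms by (auto simp: homology_trivial_def homology_space_def)
  moreover have "z \<in> homology_class K j z"
    using boundary_space_zero[OF assms(2), of j] by (force simp: homology_class_def)
  ultimately show ?thesis by (auto simp: homology_class_def)
qed

section \<open>Deleting vertices\<close>

text \<open>
  Nothing of \<open>bd W c\<close> contains \<open>v\<close>, so the part \<open>- v * bd e\<close> of the boundary vanishes.
\<close>

lemma link_part_cycle:
  assumes K: "simplicial_complex K" and v: "{v} \<in> K" "v \<notin> A"
    and W: "finite W" "K \<subseteq> Pow W"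
    and c: "c \<in> chain_space (induced_subcomplex K (insert v A)) (j + 1)"
    and z: "bd W c \<in> chain_space (induced_subcomplex K A) j"
  shows "link_part v c \<in> cycle_space (induced_subcomplex (link K {v}) A) j"
proof -
  let ?L = "induced_subcomplex (link K {v}) A"
  have vW: "v \<in> W" using v W by auto
  have L: "simplicial_complex ?L" "?L \<subseteq> Pow W"
    using complex_induced[OF complex_link[OF K v(1)]] W(2)
    by (auto simp: induced_subcomplex_def link_def)
  have cW: "\<sigma> \<subseteq> W" if "c \<sigma> \<noteq> 0" for \<sigma>
    using c W that by (auto simp: chain_space_def induced_subcomplex_def)
  have "link_part v (bd W c) = 0"
    using z v by (fastforce simp: link_part_def chain_space_def induced_subcomplex_def fun_eq_iff)
  then have "bd W (link_part v c) = 0"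
    using link_part_bd[OF W(1) vW cW] by (metis minus_equation_iff minus_zero)
  moreover have "link_part v c \<in> chain_space ?L j"
    unfolding chain_space_def
  proof (intro CollectI allI impI)
    fix \<sigma> assume "link_part v c \<sigma> \<noteq> 0"
    from link_part_support[OF this] have \<sigma>: "c (insert v \<sigma>) \<noteq> 0" "v \<notin> \<sigma>" by auto
    then have i: "insert v \<sigma> \<in> K" "insert v \<sigma> \<subseteq> insert v A" "face_dim (insert v \<sigma>) = j + 1"
      using c by (auto simp: chain_space_def induced_subcomplex_def)
    then have "\<sigma> \<in> K" "finite \<sigma>" using K by (auto intro: complex_subset dest: complex_finite)
    then show "\<sigma> \<in> ?L \<and> face_dim \<sigma> = j"
      using i \<sigma> face_dim_insert[of \<sigma> v] by (auto simp: induced_subcomplex_def link_def)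
  qed
  ultimately show ?thesis using cycle_space_bd[OF L(1) W(1) L(2)] by blast
qed

text \<open>
  The cone over \<open>e = link_part v c\<close> is traded for a chain \<open>f\<close> of the link with boundary \<open>e\<close>.
\<close>

lemma boundary_delete_vertex_chain:
  assumes K: "simplicial_complex K" and v: "{v} \<in> K" "v \<notin> A"
    and W: "finite W" "K \<subseteq> Pow W"
    and c: "c \<in> chain_space (induced_subcomplex K (insert v A)) (j + 1)"
    and z: "bd W c \<in> chain_space (induced_subcomplex K A) j"
    and e: "link_part v c \<in> boundary_space (induced_subcomplex (link K {v}) A) j"
  shows "bd W c \<in> boundary_space (induced_subcomplex K A) j"
proof -
  let ?L = "induced_subcomplex (link K {v}) A" and ?K = "induced_subcomplex K A"
  have vW: "v \<in> W" using v W by auto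
  have L: "simplicial_complex ?L" "?L \<subseteq> Pow W" "?L \<subseteq> ?K"
    using complex_induced[OF complex_link[OF K v(1)]] W(2)
    by (auto simp: induced_subcomplex_def link_def)
  have KA: "simplicial_complex ?K" "?K \<subseteq> Pow W"
    using complex_induced[OF K] W(2) induced_subset by blast+
  obtain f where f: "f \<in> chain_space ?L (j + 1)" "bd W f = link_part v c"
    using e boundary_space_bd[OF L(1) W(1) L(2)] by blast
  have "avoiding v (bd W c) = bd W c"
    using z v by (fastforce simp: avoiding_def chain_space_def induced_subcomplex_def fun_eq_iff)
  then have "bd W (avoiding v c + f) = bd W c"
    using avoiding_bd[OF W(1) vW, of c] f(2) by (simp only: bd_add)
  moreover have "avoiding v c \<in> chain_space ?K (j + 1)"
    using c by (fastforce simp: avoiding_def chain_space_def induced_subcomplex_def)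
  then have "avoiding v c + f \<in> chain_space ?K (j + 1)"
    using f(1) L(3) chain_space_mono chain_space_add by blast
  ultimately show ?thesis using boundary_space_bd[OF KA(1) W(1) KA(2)] by blast
qed

lemma boundary_delete_vertex:
  fixes z :: "'v set \<Rightarrow> 'f::field"
  assumes K: "simplicial_complex K" and v: "v \<notin> A"
    and z: "z \<in> boundary_space (induced_subcomplex K (insert v A)) j"
      "z \<in> chain_space (induced_subcomplex K A) j"
    and fill: "\<And>e :: 'v set \<Rightarrow> 'f. {v} \<in> K \<Longrightarrow> e \<in> cycle_space (induced_subcomplex (link K {v}) A) j
      \<Longrightarrow> e \<in> boundary_space (induced_subcomplex (link K {v}) A) j"
  shows "z \<in> boundary_space (induced_subcomplex K A) j"
proof (cases "{v} \<in> K")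
  case False
  then have "v \<notin> \<sigma>" if "\<sigma> \<in> K" for \<sigma>
    using complex_subset[OF K that, of "{v}"] by blast
  then have "induced_subcomplex K (insert v A) = induced_subcomplex K A"
    by (auto simp: induced_subcomplex_def)
  then show ?thesis using z by simp
next
  case True
  note W = finite_vertices[OF K] complex_Pow_vertices[of K]
  obtain c where c: "c \<in> chain_space (induced_subcomplex K (insert v A)) (j + 1)"
    and bd: "bd (vertices K) c = z"
    using z(1) boundary_space_bd[OF complex_induced[OF K] W(1)] W(2) induced_subset
    by (metis subset_trans)
  have "link_part v c \<in> boundary_space (induced_subcomplex (link K {v}) A) j"
    using fill[OF True] link_part_cycle[OF K True v W c] z(2) bd by simp
  then show ?thesis
    using boundary_delete_vertex_chain[OF K True v W c] z(2) bd by simp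
qed

text \<open>
  The set \<open>A'\<close> consists of \<open>A\<close> and the vertices of \<open>B\<close> still to be deleted after \<open>v\<close>.
\<close>

lemma boundary_delete_vertices:
  fixes z :: "'v set \<Rightarrow> 'f::field"
  assumes "finite B" "A \<inter> B = {}" and K: "simplicial_complex K"
    and z: "z \<in> boundary_space (induced_subcomplex K (A \<union> B)) j"
      "z \<in> chain_space (induced_subcomplex K A) j"
    and fill: "\<And>v A' (e :: 'v set \<Rightarrow> 'f). v \<in> B \<Longrightarrow> {v} \<in> K \<Longrightarrow> A \<subseteq> A' \<Longrightarrow> A' \<subseteq> (A \<union> B) - {v}
      \<Longrightarrow> e \<in> cycle_space (induced_subcomplex (link K {v}) A') j
      \<Longrightarrow> e \<in> boundary_space (induced_subcomplex (link K {v}) A') j"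
  shows "z \<in> boundary_space (induced_subcomplex K A) j"
  using assms(1,2) z(1) fill
proof (induction B rule: finite_induct)
  case empty
  then show ?case by simp
next
  case (insert v B)
  have "induced_subcomplex K A \<subseteq> induced_subcomplex K (A \<union> B)"
    by (auto simp: induced_subcomplex_def)
  then have zB: "z \<in> chain_space (induced_subcomplex K (A \<union> B)) j"
    using z(2) chain_space_mono by blast
  have "z \<in> boundary_space (induced_subcomplex K (A \<union> B)) j"
  proof (rule boundary_delete_vertex[OF K _ _ zB])
    show "v \<notin> A \<union> B" using insert.prems insert.hyps by blast
    then show "e \<in> boundary_space (induced_subcomplex (link K {v}) (A \<union> B)) j"
      if "{v} \<in> K" "e \<in> cycle_space (induced_subcomplex (link K {v}) (A \<union> B)) j" for e :: "'v set \<Rightarrow> 'f"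
      using that by (intro insert.prems(3)) auto
    show "z \<in> boundary_space (induced_subcomplex K (insert v (A \<union> B))) j"
      using insert.prems(2) by simp
  qed
  moreover have "A \<inter> B = {}" using insert.prems(1) by blast
  moreover have "e \<in> boundary_space (induced_subcomplex (link K {w}) A') j"
    if "w \<in> B" "{w} \<in> K" "A \<subseteq> A'" "A' \<subseteq> A \<union> B - {w}"
      "e \<in> cycle_space (induced_subcomplex (link K {w}) A') j" for w A' and e :: "'v set \<Rightarrow> 'f"
    using that by (intro insert.prems(3)) auto
  ultimately show ?case using insert.IH by blast
qed

section \<open>High degrees in a stacked manifold with boundary\<close>

lemma pure_dim_bound:
  assumes "simplicial_complex K" "pure_dim n K" "\<sigma> \<in> K"
  shows "face_dim \<sigma> \<le> n"
proof -
  have "finite K" using assms(1) by (simp add: simplicial_complex_def)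
  then obtain \<beta> where \<beta>: "\<beta> \<in> K" "\<sigma> \<subseteq> \<beta>" "\<And>\<gamma>. \<gamma> \<in> K \<Longrightarrow> \<beta> \<subseteq> \<gamma> \<Longrightarrow> \<gamma> = \<beta>"
    using finite_has_maximal2[of K \<sigma>] assms(3) by metis
  then have "face_dim \<beta> = n" using assms(2) by (auto simp: pure_dim_def)
  then show ?thesis
    using card_mono[OF complex_finite[OF assms(1) \<beta>(1)] \<beta>(2)] by (simp add: face_dim_def)
qed

lemma link_face_dim:
  assumes "simplicial_complex K" "\<And>\<sigma>. \<sigma> \<in> K \<Longrightarrow> face_dim \<sigma> \<le> n" "\<gamma> \<in> link K \<alpha>"
  shows "face_dim \<gamma> \<le> n - int (card \<alpha>)"
proof -
  have "\<gamma> \<union> \<alpha> \<in> K" "\<gamma> \<inter> \<alpha> = {}" using assms(3) by (auto simp: link_def)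
  moreover from this have "finite (\<gamma> \<union> \<alpha>)" using complex_finite[OF assms(1)] by blast
  ultimately show ?thesis using assms(2)[of "\<gamma> \<union> \<alpha>"] by (simp add: face_dim_def card_Un_disjoint)
qed

text \<open>
  For a nonempty face \<open>\<alpha>\<close>, whose link is acyclic, this says that the homology of the link relative
  to its induced subcomplexes vanishes in degrees above \<open>k\<close>.  Topologically that is duality together
  with the absence of interior faces of small dimension; the induction replaces duality by counting dimensions.
  The empty face gives the statement on \<open>X\<close> itself.
\<close>

lemma boundary_restricts_high_degree_stacked:
  fixes z :: "'v set \<Rightarrow> 'f::field"
  assumes X: "simplicial_complex X" and dim: "\<And>\<sigma>. \<sigma> \<in> X \<Longrightarrow> face_dim \<sigma> \<le> d + 1"
    and acyclic: "\<And>\<alpha>. \<alpha> \<in> X \<Longrightarrow> \<alpha> \<noteq> {} \<Longrightarrow> face_dim \<alpha> \<le> d - k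
      \<Longrightarrow> trivial_reduced_homology TYPE('f) (link X \<alpha>)"
    and "\<alpha> \<in> X" "face_dim \<alpha> \<le> d - k" "k \<le> j"
    and "z \<in> chain_space (induced_subcomplex (link X \<alpha>) A) j"
    and "z \<in> boundary_space (link X \<alpha>) j"
  shows "z \<in> boundary_space (induced_subcomplex (link X \<alpha>) A) j"
  using assms(4-8)
proof (induction "nat (d - k - face_dim \<alpha>)" arbitrary: \<alpha> A z rule: less_induct)
  case less
  let ?L = "link X \<alpha>" and ?B = "vertices X - A"
  have L: "simplicial_complex ?L" using complex_link[OF X less.prems(1)] .
  have LV: "?L \<subseteq> Pow (A \<union> ?B)" using link_subset[of X \<alpha>] complex_Pow_vertices[of X] by blast
  show ?case
  proof (cases "face_dim \<alpha> = d - k")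
    case True
    \<comment> \<open>The link has dimension at most \<open>k\<close>, so the only boundary in degree \<open>j\<close> is zero.\<close>
    have "face_dim \<sigma> \<noteq> j + 1" if "\<sigma> \<in> ?L" for \<sigma>
      using link_face_dim[OF X dim that] True less.prems(3) by (simp add: face_dim_def)
    then have "c = 0" if "c \<in> chain_space ?L (j + 1)" for c :: "'v set \<Rightarrow> 'f"
      using chain_space_no_faces[OF _ that] by blast
    then have "z = 0"
      using less.prems(5) boundary_space_bd[OF L finite_vertices[OF L] complex_Pow_vertices] bd_zero
      by metis
    then show ?thesis using boundary_space_zero[OF complex_induced[OF L]] by simp
  next
    case False
    show ?thesis
    proof (rule boundary_delete_vertices[where B = ?B])
      show "finite ?B" using finite_vertices[OF X] by simp
      show "z \<in> boundary_space (induced_subcomplex ?L (A \<union> ?B)) j"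
        using less.prems(5) induced_all[OF LV] by simp
      show "z \<in> chain_space (induced_subcomplex ?L A) j" by fact
      fix v A' and e :: "'v set \<Rightarrow> 'f"
      assume v: "{v} \<in> ?L" and e: "e \<in> cycle_space (induced_subcomplex (link ?L {v}) A') j"
      let ?\<beta> = "insert v \<alpha>"
      have \<beta>: "v \<notin> \<alpha>" "?\<beta> \<in> X" "finite \<alpha>"
        using v vertex_in_link[OF X] complex_finite[OF X less.prems(1)] by auto
      then have d\<beta>: "face_dim ?\<beta> = face_dim \<alpha> + 1" by (simp add: face_dim_insert)
      have L\<beta>: "simplicial_complex (link X ?\<beta>)" using complex_link[OF X \<beta>(2)] .
      have e': "e \<in> cycle_space (induced_subcomplex (link X ?\<beta>) A') j"
        using e link_link[OF \<beta>(1) X] by simp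
      then have "e \<in> cycle_space (link X ?\<beta>) j"
        using cycle_space_mono[OF L\<beta> complex_induced[OF L\<beta>] induced_subset] by blast
      \<comment> \<open>The larger face \<open>?\<beta>\<close> is still of dimension at most \<open>d - k\<close>.\<close>
      then have "e \<in> boundary_space (link X ?\<beta>) j"
        using acyclic[OF \<beta>(2)] less.prems(2) d\<beta> False
        by (intro trivial_homology_cycle_bounds L\<beta>) (auto simp: trivial_reduced_homology_def)
      then have "e \<in> boundary_space (induced_subcomplex (link X ?\<beta>) A') j"
        using less.prems(2,3) d\<beta> False e' \<beta>(2)
        by (intro less.hyps) (auto simp: cycle_space_def)
      then show "e \<in> boundary_space (induced_subcomplex (link ?L {v}) A') j"
        using link_link[OF \<beta>(1) X] by simp
    qed (use L in auto)
  qed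
qed

section \<open>Top-dimensional cycles\<close>

lemma link_part_nonzero_iff: "link_part v z \<noteq> 0 \<longleftrightarrow> (\<exists>\<sigma>. v \<in> \<sigma> \<and> z \<sigma> \<noteq> 0)"
proof
  assume "link_part v z \<noteq> 0"
  then obtain \<tau> where "link_part v z \<tau> \<noteq> 0" by (auto simp: fun_eq_iff)
  from link_part_support[OF this] show "\<exists>\<sigma>. v \<in> \<sigma> \<and> z \<sigma> \<noteq> 0" by blast
next
  assume "\<exists>\<sigma>. v \<in> \<sigma> \<and> z \<sigma> \<noteq> 0"
  then obtain \<sigma> where "v \<in> \<sigma>" "z \<sigma> \<noteq> 0" by blast
  then have "link_part v z (\<sigma> - {v}) \<noteq> 0" by (simp add: link_part_def insert_absorb)
  then show "link_part v z \<noteq> 0" by (metis zero_fun_apply)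
qed

lemma link_part_cycle_of_cycle:
  assumes K: "simplicial_complex K" and v: "{v} \<in> K" and z: "z \<in> cycle_space K (j + 1)"
  shows "link_part v z \<in> cycle_space (link K {v}) j"
proof -
  let ?W = "vertices K"
  note W = finite_vertices[OF K] complex_Pow_vertices[of K]
  have z': "z \<in> chain_space K (j + 1)" "bd ?W z = 0"
    using z cycle_space_bd[OF K W] by auto
  have "v \<in> ?W" using v W by blast
  then have "induced_subcomplex K (insert v (?W - {v})) = K"
    using induced_all[OF W(2)] by (simp add: insert_absorb)
  moreover have "induced_subcomplex (link K {v}) (?W - {v}) = link K {v}"
    using W(2) by (auto simp: induced_subcomplex_def link_def)
  ultimately show ?thesis
    using link_part_cycle[OF K v _ W, of "?W - {v}" z j] z' by (simp add: chain_space_zero)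
qed

text \<open>
  Without faces of dimension \<open>j + 1\<close> there are no boundaries in degree \<open>j\<close>, so the cycles themselves
  form a line.
\<close>

lemma homology_line_generator:
  fixes K :: "'v set set"
  assumes iso: "homology_iso_field TYPE('f::field) K j"
    and top: "\<And>\<sigma>. \<sigma> \<in> K \<Longrightarrow> face_dim \<sigma> \<noteq> j + 1"
  obtains y :: "'v set \<Rightarrow> 'f::field" where "y \<in> cycle_space K j" "y \<noteq> 0"
    "\<And>z. z \<in> cycle_space K j \<Longrightarrow> \<exists>a. z = (\<lambda>\<sigma>. a * y \<sigma>)"
proof -
  have "chain_space K (j + 1) = {0 :: 'v set \<Rightarrow> 'f}"
    using chain_space_no_faces[OF top] chain_space_zero by blast
  moreover have "chain_boundary K (0 :: 'v set \<Rightarrow> 'f) = 0"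
    by (auto simp: chain_boundary_def fun_eq_iff)
  ultimately have cls: "homology_class K j z = {z}" for z :: "'v set \<Rightarrow> 'f"
    by (simp add: homology_class_def boundary_space_def)
  obtain \<phi> :: "('v set \<Rightarrow> 'f) set \<Rightarrow> 'f"
    where bij: "bij_betw \<phi> (homology_space K j) UNIV"
      and scale: "\<And>a z. z \<in> cycle_space K j \<Longrightarrow> \<phi> {\<lambda>\<sigma>. a * z \<sigma>} = a * \<phi> {z}"
    using iso unfolding homology_iso_field_def cls by blast
  have space: "homology_space K j = (\<lambda>z :: 'v set \<Rightarrow> 'f. {z}) ` cycle_space K j"
    unfolding homology_space_def cls ..
  have "1 \<in> \<phi> ` homology_space K j" using bij by (simp add: bij_betw_def)
  then obtain y where y: "y \<in> cycle_space K j" "\<phi> {y} = 1" unfolding space by auto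
  have "chain_boundary K (\<lambda>\<sigma>. a * y \<sigma>) = (\<lambda>\<sigma>. a * chain_boundary K y \<sigma>)" for a
    by (auto simp: chain_boundary_def fun_eq_iff sum_distrib_left mult.left_commute)
  then have scale_cycle: "(\<lambda>\<sigma>. a * y \<sigma>) \<in> cycle_space K j" for a
    using y(1) chain_space_scale[of y K j a] by (auto simp: cycle_space_def)
  show thesis
  proof
    show "y \<in> cycle_space K j" by fact
    show "y \<noteq> 0" using scale[OF y(1), of 0] y(2) by (auto simp: zero_fun_def)
    fix z :: "'v set \<Rightarrow> 'f" assume z: "z \<in> cycle_space K j"
    have "\<phi> {\<lambda>\<sigma>. \<phi> {z} * y \<sigma>} = \<phi> {z}" using scale[OF y(1)] y(2) by simp
    then have "{\<lambda>\<sigma>. \<phi> {z} * y \<sigma>} = {z}"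
      using bij scale_cycle z by (auto simp: bij_betw_def inj_on_def space)
    then show "\<exists>a. z = (\<lambda>\<sigma>. a * y \<sigma>)" by (metis singleton_inject)
  qed
qed

lemma homology_line_multiple:
  fixes x z :: "'v set \<Rightarrow> 'f::field"
  assumes "homology_iso_field TYPE('f) K j" "\<And>\<sigma>. \<sigma> \<in> K \<Longrightarrow> face_dim \<sigma> \<noteq> j + 1"
    and "x \<in> cycle_space K j" "x \<noteq> 0" "z \<in> cycle_space K j"
  shows "\<exists>a. z = (\<lambda>\<sigma>. a * x \<sigma>)"
proof -
  obtain y :: "'v set \<Rightarrow> 'f"
    where y: "\<And>z. z \<in> cycle_space K j \<Longrightarrow> \<exists>a. z = (\<lambda>\<sigma>. a * y \<sigma>)"
    using homology_line_generator[OF assms(1,2)] by metis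
  obtain a b where ab: "x = (\<lambda>\<sigma>. a * y \<sigma>)" "z = (\<lambda>\<sigma>. b * y \<sigma>)" using y assms by metis
  then have "a \<noteq> 0" using assms(4) by (auto simp: fun_eq_iff)
  then have "z = (\<lambda>\<sigma>. (b / a) * x \<sigma>)" using ab by simp
  then show ?thesis by blast
qed

lemma point_difference_cycle:
  assumes K: "simplicial_complex K" and uv: "{u} \<in> K" "{v} \<in> K"
  shows "(\<lambda>\<sigma>. (if \<sigma> = {v} then 1 else 0) - (if \<sigma> = {u} then 1 else 0) :: 'f::field) \<in> cycle_space K 0"
    (is "?y \<in> _")
proof -
  let ?W = "vertices K"
  note W = finite_vertices[OF K] complex_Pow_vertices[of K]
  have "bd ?W ?y \<tau> = 0" for \<tau>
  proof (cases "\<tau> = {}")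
    case True
    have "u \<in> ?W" "v \<in> ?W" using uv by (auto simp: vertices_def)
    then show ?thesis
      using True W(1) by (simp add: bd_def incidence_def sum_subtractf)
  next
    case False
    then have "insert x \<tau> \<noteq> {w}" if "x \<notin> \<tau>" for x w using that by blast
    then show ?thesis by (auto simp: bd_def intro!: sum.neutral)
  qed
  then have "bd ?W ?y = 0" by (simp add: fun_eq_iff)
  moreover have "?y \<in> chain_space K 0" using uv by (auto simp: chain_space_def face_dim_def)
  ultimately show ?thesis using cycle_space_bd[OF K W] by blast
qed

text \<open>
  Suppose that \<open>u\<close> and \<open>v\<close> lie in different components and that \<open>c\<close> is a 1-chain with boundary
  \<open>[v] - [u]\<close>.  Its part in the component of \<open>u\<close> has boundary \<open>- [u]\<close>, which is not a reduced cycle.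
\<close>

lemma connected_if_trivial_homology_0:
  assumes K: "simplicial_complex K" and H: "homology_trivial TYPE('f::field) K 0"
  shows "connected_complex K"
proof (rule ccontr)
  let ?W = "vertices K" and ?E = "{(a, b). {a, b} \<in> K}"
  note W = finite_vertices[OF K] complex_Pow_vertices[of K]
  assume "\<not> connected_complex K"
  then obtain u v where uv: "u \<in> ?W" "v \<in> ?W" "(u, v) \<notin> ?E\<^sup>*"
    unfolding connected_complex_def by blast
  define S where "S = {w. (u, w) \<in> ?E\<^sup>*}"
  have S: "u \<in> S" "v \<notin> S" "\<And>x w. {x, w} \<in> K \<Longrightarrow> w \<in> S \<Longrightarrow> x \<in> S"
    using uv by (auto simp: S_def insert_commute intro: rtrancl_into_rtrancl)
  let ?y = "\<lambda>\<sigma>. (if \<sigma> = {v} then 1 else 0) - (if \<sigma> = {u} then 1 else 0) :: 'f"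
  have "?y \<in> boundary_space K 0"
    using uv vertices_iff[OF K] by (intro trivial_homology_cycle_bounds H K point_difference_cycle) auto
  then obtain c where c: "c \<in> chain_space K 1" "bd ?W c = ?y"
    using boundary_space_bd[OF K W] by force
  define c' where "c' = (\<lambda>\<sigma>. if \<sigma> \<subseteq> S then c \<sigma> else 0)"
  have bd': "bd ?W c' = (\<lambda>\<sigma>. if \<sigma> = {u} then - 1 else 0)"
  proof
    fix \<tau>
    consider (in_S) w where "\<tau> = {w}" "w \<in> S" | (not_in_S) w where "\<tau> = {w}" "w \<notin> S"
      | (no_point) "\<And>w. \<tau> \<noteq> {w}" by blast
    then show "bd ?W c' \<tau> = (if \<tau> = {u} then - 1 else 0)"
    proof cases
      case in_S
      have "c' (insert x \<tau>) = c (insert x \<tau>)" for x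
        using in_S S(3)[of x w] c(1) by (auto simp: c'_def chain_space_def)
      then have "bd ?W c' \<tau> = bd ?W c \<tau>" by (simp add: bd_def)
      then show ?thesis using c(2) in_S S by auto
    next
      case not_in_S
      then show ?thesis using S by (auto simp: bd_def c'_def)
    next
      case no_point
      have "c (insert x \<tau>) = 0" if "x \<notin> \<tau>" for x
      proof (rule ccontr)
        assume "c (insert x \<tau>) \<noteq> 0"
        then have "insert x \<tau> \<in> K" "face_dim (insert x \<tau>) = 1" using c(1) by (auto simp: chain_space_def)
        then have "card \<tau> = 1"
          using that complex_finite[OF K] by (fastforce simp: face_dim_def)
        then show False using no_point by (auto simp: card_1_singleton_iff)
      qed
      then have "bd ?W c' \<tau> = 0" unfolding bd_def c'_def by (intro sum.neutral) auto
      then show ?thesis using no_point by auto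
    qed
  qed
  have "bd ?W (bd ?W c') = 0"
    using c(1) W by (intro bd_bd) (auto simp: c'_def chain_space_def split: if_splits)
  then have "bd ?W (bd ?W c') {} = 0" by simp
  then show False using W(1) uv(1) unfolding bd' by (simp add: bd_def incidence_def)
qed

lemma homology_manifold_face_dim:
  assumes "homology_manifold F d M" "\<sigma> \<in> M"
  shows "face_dim \<sigma> \<le> d"
  using assms pure_dim_bound by (auto simp: homology_manifold_def)

lemma homology_manifold_link:
  assumes M: "homology_manifold TYPE('f::field) d M" and \<alpha>: "\<alpha> \<in> M" "\<alpha> \<noteq> {}"
  shows "homology_iso_field TYPE('f) (link M \<alpha>) (d - int (card \<alpha>))"
    and "j \<noteq> d - int (card \<alpha>) \<Longrightarrow> homology_trivial TYPE('f) (link M \<alpha>) j"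
  using assms by (auto simp: homology_manifold_def sphere_reduced_homology_def split: if_splits)

text \<open>
  The set of vertices involved in \<open>z\<close> is nonempty, and the link is connected if its dimension is
  positive, so it suffices to pass along an edge from \<open>w\<close> to \<open>x\<close>.  If \<open>w\<close> is involved, the contraction of \<open>z\<close>
  along \<open>w\<close> is a nonzero top-dimensional cycle of a smaller link, and by induction it involves \<open>x\<close>.
  If the dimension is zero, the cycles form a line containing the difference of any two vertices.
\<close>

lemma top_cycle_meets_every_vertex:
  fixes z :: "'v set \<Rightarrow> 'f::field"
  assumes M: "homology_manifold TYPE('f) d M" and conn: "connected_complex M" "1 \<le> d"
    and "\<alpha> \<in> M" "z \<in> cycle_space (link M \<alpha>) (d - int (card \<alpha>))" "z \<noteq> 0" "{v} \<in> link M \<alpha>"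
  shows "link_part v z \<noteq> 0"
  using assms(4-7)
proof (induction "nat (d - int (card \<alpha>))" arbitrary: \<alpha> z v rule: less_induct)
  case less
  let ?K = "link M \<alpha>" and ?s = "d - int (card \<alpha>)"
  have MC: "simplicial_complex M" using M by (simp add: homology_manifold_def)
  have K: "simplicial_complex ?K" using complex_link[OF MC less.prems(1)] .
  have fin: "finite \<alpha>" using complex_finite[OF MC less.prems(1)] .
  have dim: "face_dim \<gamma> \<le> ?s" if "\<gamma> \<in> ?K" for \<gamma>
    using link_face_dim[OF MC _ that] homology_manifold_face_dim[OF M] by blast
  have z: "\<sigma> \<in> ?K" "face_dim \<sigma> = ?s" if "z \<sigma> \<noteq> 0" for \<sigma>
    using that less.prems(2) by (auto simp: cycle_space_def chain_space_def)
  have s: "0 \<le> ?s"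
    using dim[OF less.prems(4)] by (simp add: face_dim_def)
  obtain \<sigma> where \<sigma>: "z \<sigma> \<noteq> 0" using less.prems(3) by (auto simp: fun_eq_iff)
  have "int (card \<sigma>) \<ge> 1" using z(2)[OF \<sigma>] s by (simp add: face_dim_def)
  then obtain u where u: "u \<in> \<sigma>" by fastforce
  have uK: "{u} \<in> ?K" using complex_subset[OF K z(1)[OF \<sigma>]] u by blast
  show ?case
  proof (cases "?s = 0")
    case True
    then have "\<alpha> \<noteq> {}" using conn(2) by auto
    have "card \<sigma> = 1" using z(2)[OF \<sigma>] True by (simp add: face_dim_def)
    then have zu: "z {u} \<noteq> 0" using u \<sigma> by (auto simp: card_1_singleton_iff)
    have "z {v} \<noteq> 0"
    proof (cases "v = u")
      case False
      let ?y = "\<lambda>\<sigma>. (if \<sigma> = {v} then 1 else 0) - (if \<sigma> = {u} then 1 else 0) :: 'f"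
      have "\<exists>a. ?y = (\<lambda>\<sigma>. a * z \<sigma>)"
      proof (rule homology_line_multiple)
        show "homology_iso_field TYPE('f) ?K 0"
          using homology_manifold_link(1)[OF M less.prems(1) \<open>\<alpha> \<noteq> {}\<close>] True by simp
        show "face_dim \<sigma> \<noteq> 0 + 1" if "\<sigma> \<in> ?K" for \<sigma> using dim[OF that] True by simp
        show "?y \<in> cycle_space ?K 0" using point_difference_cycle[OF K uK less.prems(4)] .
      qed (use less.prems True in auto)
      then obtain a where a: "?y = (\<lambda>\<sigma>. a * z \<sigma>)" by blast
      from fun_cong[OF a, of "{v}"] show ?thesis using False by auto
    qed (use zu in simp)
    then show ?thesis unfolding link_part_nonzero_iff by blast
  next
    case False
    have "connected_complex ?K"
    proof (cases "\<alpha> = {}")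
      case True
      then show ?thesis using conn(1) by (simp add: link_empty)
    next
      case ne: False
      show ?thesis
        using homology_manifold_link(2)[OF M less.prems(1) ne, of 0] False
        by (intro connected_if_trivial_homology_0[OF K]) auto
    qed
    then have "(u, v) \<in> {(a, b). {a, b} \<in> ?K}\<^sup>*"
      using uK less.prems(4) vertices_iff[OF K] by (auto simp: connected_complex_def)
    then show ?thesis
    proof (induction rule: rtrancl_induct)
      case base
      show ?case using u \<sigma> unfolding link_part_nonzero_iff by blast
    next
      case (step w x)
      show ?case
      proof (cases "w = x")
        case wx: False
        let ?\<beta> = "insert w \<alpha>"
        have "{w, x} \<in> ?K" using step.hyps(2) by simp
        then have wK: "{w} \<in> ?K" using complex_subset[OF K] by blast
        then have \<beta>: "w \<notin> \<alpha>" "?\<beta> \<in> M" using vertex_in_link[OF MC] by auto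
        have ll: "link ?K {w} = link M ?\<beta>" using link_link[OF \<beta>(1) MC] .
        have xL: "{x} \<in> link M ?\<beta>"
          using \<open>{w, x} \<in> ?K\<close> wx complex_subset[OF K \<open>{w, x} \<in> ?K\<close>, of "{x}"]
          by (auto simp: ll[symmetric] link_def[of ?K] insert_commute)
        have "link_part w z \<in> cycle_space (link M ?\<beta>) (d - int (card ?\<beta>))"
          using link_part_cycle_of_cycle[OF K wK, of z "?s - 1"] less.prems(2) \<beta>(1) fin ll
          by (simp add: algebra_simps)
        then have "link_part x (link_part w z) \<noteq> 0"
          using \<beta> xL step.IH fin s False by (intro less.hyps[of ?\<beta> "link_part w z" x]) auto
        then obtain \<tau> where "x \<in> \<tau>" "link_part w z \<tau> \<noteq> 0" unfolding link_part_nonzero_iff by blast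
        with link_part_support[OF this(2)] show ?thesis
          unfolding link_part_nonzero_iff by blast
      qed (use step.IH in simp)
    qed
  qed
qed

section \<open>High degrees in a neighbourly manifold\<close>

text \<open>
  The link is a homology sphere, so only its top degree is in question.  In that degree \<open>\<alpha>\<close> has at most
  \<open>k\<close> vertices, so by neighbourliness every vertex outside \<open>\<alpha>\<close> belongs to the link, and a cycle
  missing one of them is zero.
\<close>

lemma high_degree_cycle_in_proper_link_bounds:
  fixes e :: "'v set \<Rightarrow> 'f::field"
  assumes M: "homology_manifold TYPE('f) d M" and conn: "connected_complex M" "1 \<le> d"
    and nb: "\<And>A. A \<subseteq> vertices M \<Longrightarrow> int (card A) \<le> k + 1 \<Longrightarrow> A \<in> M"
    and \<alpha>: "\<alpha> \<in> M" "\<alpha> \<noteq> {}" and j: "d - k \<le> j"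
    and A: "A \<subset> vertices M - \<alpha>"
    and e: "e \<in> cycle_space (induced_subcomplex (link M \<alpha>) A) j"
  shows "e \<in> boundary_space (link M \<alpha>) j"
proof -
  have MC: "simplicial_complex M" using M by (simp add: homology_manifold_def)
  have L: "simplicial_complex (link M \<alpha>)" using complex_link[OF MC \<alpha>(1)] .
  have eL: "e \<in> cycle_space (link M \<alpha>) j"
    using cycle_space_mono[OF L complex_induced[OF L] induced_subset e] .
  show ?thesis
  proof (cases "j = d - int (card \<alpha>)")
    case False
    then show ?thesis
      using homology_manifold_link(2)[OF M \<alpha>] eL L by (intro trivial_homology_cycle_bounds)
  next
    case True
    obtain v where v: "v \<in> vertices M" "v \<notin> \<alpha>" "v \<notin> A" using A by blast
    have "\<alpha> \<subseteq> vertices M" "finite \<alpha>"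
      using \<alpha>(1) complex_finite[OF MC] by (auto simp: vertices_def)
    then have "insert v \<alpha> \<in> M" using v True j by (intro nb) auto
    then have vL: "{v} \<in> link M \<alpha>" using v(2) vertex_in_link[OF MC] by blast
    have "\<sigma> \<subseteq> A" if "e \<sigma> \<noteq> 0" for \<sigma>
      using e that by (auto simp: cycle_space_def chain_space_def induced_subcomplex_def)
    then have "link_part v e = 0" using v(3) link_part_nonzero_iff[of v e] by blast
    then have "e = 0"
      using top_cycle_meets_every_vertex[OF M conn \<alpha>(1)] eL vL True by metis
    then show ?thesis using boundary_space_zero[OF L] by simp
  qed
qed

text \<open>
  In topological terms, Alexander duality in the link matches degree \<open>j \<ge> d - k\<close> on \<open>A\<close> with a degree on the
  complementary vertex set in which neighbourliness forces the homology to vanish, provided that the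
  complement is nonempty.  This is why \<open>A\<close> must be a proper subset throughout.  In the induction
  one vertex \<open>v\<close> outside \<open>A\<close> is deleted first; afterwards all sets that occur miss \<open>v\<close>, and the
  induction hypothesis applies.  The cycle \<open>y\<^sub>0\<close> expresses orientability.
\<close>

lemma boundary_restricts_high_degree_neighbourly:
  fixes z y\<^sub>0 :: "'v set \<Rightarrow> 'f::field"
  assumes M: "homology_manifold TYPE('f) d M" and conn: "connected_complex M" "1 \<le> d"
    and y\<^sub>0: "y\<^sub>0 \<in> cycle_space M d" "y\<^sub>0 \<noteq> 0"
    and nb: "\<And>A. A \<subseteq> vertices M \<Longrightarrow> int (card A) \<le> k + 1 \<Longrightarrow> A \<in> M"
    and j: "d - k \<le> j"
    and "\<alpha> \<in> M" "int (card \<alpha>) \<le> k + 1" "A \<subset> vertices M - \<alpha>"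
    and "z \<in> chain_space (induced_subcomplex (link M \<alpha>) A) j"
    and "z \<in> boundary_space (link M \<alpha>) j"
  shows "z \<in> boundary_space (induced_subcomplex (link M \<alpha>) A) j"
  using assms(8-12)
proof (induction "nat (k + 1 - int (card \<alpha>))" arbitrary: \<alpha> A z rule: less_induct)
  case less
  let ?K = "link M \<alpha>" and ?V = "vertices M"
  have MC: "simplicial_complex M" using M by (simp add: homology_manifold_def)
  have K: "simplicial_complex ?K" using complex_link[OF MC less.prems(1)] .
  have fin: "finite \<alpha>" using complex_finite[OF MC less.prems(1)] .
  have \<alpha>V: "\<alpha> \<subseteq> ?V" using less.prems(1) by (auto simp: vertices_def)
  note W = finite_vertices[OF MC]
  have KW: "?K \<subseteq> Pow ?V" and KV: "?K \<subseteq> Pow (?V - \<alpha>)"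
    using complex_Pow_vertices[of M] by (auto simp: link_def)
  have dim: "face_dim \<gamma> \<le> d - int (card \<beta>)" if "\<gamma> \<in> link M \<beta>" for \<gamma> \<beta>
    using link_face_dim[OF MC _ that] homology_manifold_face_dim[OF M] by blast
  have A: "A \<subseteq> ?V - \<alpha>" using less.prems(3) by blast
  show ?case
  proof (cases "int (card \<alpha>) = k + 1")
    case True
    \<comment> \<open>The link has dimension at most \<open>d - k - 1\<close>, so there are no chains of degree \<open>j\<close>.\<close>
    have "face_dim \<sigma> \<noteq> j" if "\<sigma> \<in> induced_subcomplex ?K A" for \<sigma>
      using dim[of \<sigma> \<alpha>] that induced_subset[of ?K A] j True by force
    then have "z = 0" using chain_space_no_faces less.prems(4) by blast
    then show ?thesis using boundary_space_zero[OF complex_induced[OF K]] by simp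
  next
    case False
    then have small: "int (card \<alpha>) \<le> k" using less.prems(2) by simp
    have grow: "insert w \<alpha> \<in> M" if "w \<in> ?V" for w
      using that \<alpha>V fin small by (intro nb) (auto simp: card_insert_if)
    obtain v where v: "v \<in> ?V" "v \<notin> \<alpha>" "v \<notin> A" using less.prems(3) by blast
    let ?B = "?V - \<alpha> - {v}" and ?\<beta> = "insert v \<alpha>"
    have vK: "{v} \<in> ?K" using grow v vertex_in_link[OF MC] by blast
    have ll: "link ?K {v} = link M ?\<beta>" using link_link[OF v(2) MC] .
    have L: "simplicial_complex (link M ?\<beta>)" using complex_link[OF MC grow[OF v(1)]] .
    have iB: "induced_subcomplex (link ?K {v}) ?B = link M ?\<beta>"
      unfolding ll using complex_Pow_vertices[of M] by (intro induced_all) (auto simp: link_def)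
    have vB: "v \<notin> ?B" by simp
    have "insert v ?B = ?V - \<alpha>" using v by blast
    then have KB: "induced_subcomplex ?K (insert v ?B) = ?K" using induced_all[OF KV] by simp
    have "induced_subcomplex ?K A \<subseteq> induced_subcomplex ?K ?B"
      using A v by (auto simp: induced_subcomplex_def)
    then have zB: "z \<in> chain_space (induced_subcomplex ?K ?B) j"
      using less.prems(4) chain_space_mono by blast
    obtain c where c: "c \<in> chain_space ?K (j + 1)" "bd ?V c = z"
      using less.prems(5) boundary_space_bd[OF K W KW] by blast
    have e: "link_part v c \<in> cycle_space (link M ?\<beta>) j"
      using link_part_cycle[OF K vK vB W KW, of c j] c zB unfolding KB iB by simp
    \<comment> \<open>Deletion of the first vertex.\<close>
    have "z \<in> boundary_space (induced_subcomplex ?K ?B) j"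
    proof (cases "j = d - int (card ?\<beta>)")
      case False
      then have "link_part v c \<in> boundary_space (link M ?\<beta>) j"
        using homology_manifold_link(2)[OF M grow[OF v(1)]] e L
        by (intro trivial_homology_cycle_bounds) auto
      then show ?thesis
        using boundary_delete_vertex_chain[OF K vK vB W KW, of c j] c zB unfolding KB iB by simp
    next
      case True
      then have j1: "j + 1 = d - int (card \<alpha>)" using v(2) fin by simp
      \<comment> \<open>The part of \<open>c\<close> at \<open>v\<close> is a top-dimensional cycle of a sphere and need not bound.  Subtracting a multiple of a top-dimensional cycle \<open>y\<close> of \<open>?K\<close> from \<open>c\<close> removes it without changing the boundary.\<close>
      have "\<exists>y :: 'v set \<Rightarrow> 'f. y \<in> cycle_space ?K (j + 1) \<and> y \<noteq> 0"
      proof (cases "\<alpha> = {}")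
        case True
        then show ?thesis using y\<^sub>0 j1 by (auto simp: link_empty)
      next
        case ne: False
        have "face_dim \<sigma> \<noteq> d - int (card \<alpha>) + 1" if "\<sigma> \<in> ?K" for \<sigma> using dim[OF that] by simp
        then show ?thesis
          using homology_line_generator[OF homology_manifold_link(1)[OF M less.prems(1) ne]] j1
          by metis
      qed
      then obtain y :: "'v set \<Rightarrow> 'f" where y: "y \<in> cycle_space ?K (j + 1)" "y \<noteq> 0" by blast
      have yc: "y \<in> chain_space ?K (j + 1)" "bd ?V y = 0" using y(1) cycle_space_bd[OF K W KW] by auto
      have "link_part v y \<noteq> 0"
        using top_cycle_meets_every_vertex[OF M conn less.prems(1) _ y(2) vK] y(1) j1 by simp
      moreover have "link_part v y \<in> cycle_space (link M ?\<beta>) j"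
        using link_part_cycle_of_cycle[OF K vK y(1)] ll by simp
      moreover have "face_dim \<sigma> \<noteq> j + 1" if "\<sigma> \<in> link M ?\<beta>" for \<sigma>
        using dim[OF that] True by simp
      moreover have "homology_iso_field TYPE('f) (link M ?\<beta>) j"
        using homology_manifold_link(1)[OF M grow[OF v(1)]] True by simp
      ultimately obtain a where a: "link_part v c = (\<lambda>\<sigma>. a * link_part v y \<sigma>)"
        using homology_line_multiple e by blast
      define c' where "c' = c - (\<lambda>\<sigma>. a * y \<sigma>)"
      have "link_part v c' \<sigma> = link_part v c \<sigma> - a * link_part v y \<sigma>" for \<sigma>
        by (simp add: c'_def link_part_def algebra_simps)
      then have "link_part v c' = 0" unfolding a by (simp add: fun_eq_iff)
      moreover have "(0 :: 'v set \<Rightarrow> 'f) \<in> boundary_space (link M ?\<beta>) j"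
        using boundary_space_zero[OF L] .
      moreover have "bd ?V c' = z"
        unfolding c'_def bd_diff bd_scale yc(2) c(2) by (simp add: fun_eq_iff)
      moreover have "c' \<in> chain_space ?K (j + 1)"
        unfolding c'_def using c(1) yc(1) by (intro chain_space_diff chain_space_scale)
      ultimately show ?thesis
        using boundary_delete_vertex_chain[OF K vK vB W KW, of c' j] zB
        unfolding KB iB by simp
    qed
    moreover have "A \<union> (?B - A) = ?B" using A v(3) by blast
    ultimately have zAB: "z \<in> boundary_space (induced_subcomplex ?K (A \<union> (?B - A))) j" by simp
    show ?thesis
    proof (rule boundary_delete_vertices[OF _ _ K zAB less.prems(4)])
      show "finite (?B - A)" using W by simp
      fix w A' and e :: "'v set \<Rightarrow> 'f"
      assume w: "w \<in> ?B - A" and A': "A' \<subseteq> A \<union> (?B - A) - {w}"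
        and e: "e \<in> cycle_space (induced_subcomplex (link ?K {w}) A') j"
      let ?\<beta> = "insert w \<alpha>"
      have ll: "link ?K {w} = link M ?\<beta>" using w link_link[OF _ MC] by blast
      have \<beta>: "?\<beta> \<in> M" "card ?\<beta> = card \<alpha> + 1" using grow w fin by auto
      have A'': "A' \<subset> ?V - ?\<beta>" using A' A v w by blast
      have e': "e \<in> cycle_space (induced_subcomplex (link M ?\<beta>) A') j" using e ll by simp
      have "e \<in> boundary_space (link M ?\<beta>) j"
        using high_degree_cycle_in_proper_link_bounds[OF M conn nb \<beta>(1) _ j A'' e'] by simp
      then have "e \<in> boundary_space (induced_subcomplex (link M ?\<beta>) A') j"
        using \<beta> small A'' e' by (intro less.hyps) (auto simp: cycle_space_def)
      then show "e \<in> boundary_space (induced_subcomplex (link ?K {w}) A') j" using ll by simp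
    qed auto
  qed
qed

section \<open>Low degrees\<close>

text \<open>
  The cone over the part of \<open>z\<close> avoiding a vertex \<open>a\<close> has boundary \<open>z\<close>, and its faces have at most
  \<open>j + 2\<close> vertices.
\<close>

lemma low_degree_cycle_bounds:
  fixes z :: "'v set \<Rightarrow> 'f::field"
  assumes K: "simplicial_complex K" and A: "A \<subseteq> vertices K" "A \<noteq> {}"
    and nb: "\<And>B. B \<subseteq> A \<Longrightarrow> int (card B) \<le> j + 2 \<Longrightarrow> B \<in> K"
    and z: "z \<in> cycle_space (induced_subcomplex K A) j"
  shows "z \<in> boundary_space (induced_subcomplex K A) j"
proof -
  let ?W = "vertices K" and ?K = "induced_subcomplex K A"
  note W = finite_vertices[OF K]
  have KA: "simplicial_complex ?K" "?K \<subseteq> Pow ?W"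
    using complex_induced[OF K] complex_Pow_vertices[of K] induced_subset by blast+
  obtain a where a: "a \<in> A" using A by blast
  then have aW: "a \<in> ?W" using A by blast
  have z': "z \<in> chain_space ?K j" "bd ?W z = 0" using z cycle_space_bd[OF KA(1) W KA(2)] by auto
  define c where "c = (\<lambda>\<sigma>. if a \<in> \<sigma> then incidence (\<sigma> - {a}) a * z (\<sigma> - {a}) else 0)"
  have link_c: "link_part a c = avoiding a z"
    by (auto simp: c_def link_part_def avoiding_def fun_eq_iff)
  have avoid_c: "avoiding a c = 0" by (auto simp: c_def avoiding_def fun_eq_iff)
  have c: "c \<in> chain_space ?K (j + 1)"
    unfolding chain_space_def
  proof (intro CollectI allI impI)
    fix \<sigma> assume "c \<sigma> \<noteq> 0"
    then have "a \<in> \<sigma>" and \<tau>: "\<sigma> - {a} \<in> ?K" "face_dim (\<sigma> - {a}) = j"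
      using z'(1) by (auto simp: c_def chain_space_def split: if_splits)
    have "finite \<sigma>" using complex_finite[OF KA(1) \<tau>(1)] by simp
    moreover have "\<sigma> \<subseteq> A" using \<tau>(1) a by (auto simp: induced_subcomplex_def)
    moreover have "face_dim \<sigma> = j + 1"
      using face_dim_insert[of "\<sigma> - {a}" a] \<tau> \<open>a \<in> \<sigma>\<close> \<open>finite \<sigma>\<close> by (simp add: insert_absorb)
    moreover from this have "\<sigma> \<in> K" using \<open>\<sigma> \<subseteq> A\<close> by (intro nb) (auto simp: face_dim_def)
    ultimately show "\<sigma> \<in> ?K \<and> face_dim \<sigma> = j + 1" by (simp add: induced_subcomplex_def)
  qed
  have "bd ?W c = z"
  proof (rule chain_eqI[of a])
    show "avoiding a (bd ?W c) = avoiding a z"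
      unfolding avoiding_bd[OF W aW] avoid_c link_c bd_zero by simp
    have "avoiding a (bd ?W z) = 0" unfolding z'(2) by (auto simp: avoiding_def)
    then have "- bd ?W (avoiding a z) = link_part a z"
      unfolding avoiding_bd[OF W aW] by (metis minus_unique)
    moreover have "link_part a (bd ?W c) = - bd ?W (avoiding a z)"
      using link_part_bd[OF W aW, of c] chain_space_support[OF c KA(2)] link_c by metis
    ultimately show "link_part a (bd ?W c) = link_part a z" by simp
  qed
  then show ?thesis using c boundary_space_bd[OF KA(1) W KA(2)] by blast
qed

section \<open>Tightness\<close>

lemma neighbourly_small_sets:
  assumes K: "simplicial_complex K" and nb: "neighbourly m K" and m: "m \<le> int (card (vertices K))"
    and A: "A \<subseteq> vertices K" "int (card A) \<le> m"
  shows "A \<in> K"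
proof -
  have "card A \<le> nat m" "nat m \<le> card (vertices K)" using m A(2) by auto
  then obtain B where B: "A \<subseteq> B" "B \<subseteq> vertices K" "card B = nat m"
    using exists_subset_between[OF _ _ A(1) finite_vertices[OF K]] by blast
  have "int (card B) = m" using B(3) A(2) by simp
  then have "B \<in> K" using nb B(2) unfolding neighbourly_def by blast
  then show ?thesis using complex_subset[OF K] B(1) by blast
qed

lemma boundary_space_diff:
  assumes "simplicial_complex K" "finite W" "K \<subseteq> Pow W"
    and "a \<in> boundary_space K j" "b \<in> boundary_space K j"
  shows "a - b \<in> boundary_space K j"
proof -
  obtain f g where "f \<in> chain_space K (j + 1)" "bd W f = a" "g \<in> chain_space K (j + 1)" "bd W g = b"
    using assms(4,5) unfolding boundary_space_bd[OF assms(1-3)] by blast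
  then have "f - g \<in> chain_space K (j + 1)" "bd W (f - g) = a - b"
    by (simp_all add: chain_space_diff bd_diff)
  then show ?thesis unfolding boundary_space_bd[OF assms(1-3)] by blast
qed

lemma boundary_space_unaugmented:
  fixes K :: "'v set set"
  assumes K: "simplicial_complex K" and j: "0 \<le> j"
  shows "boundary_space (K - {{}}) j = (boundary_space K j :: ('v set \<Rightarrow> 'f::field) set)"
proof -
  note W = finite_vertices[OF K] complex_Pow_vertices[of K]
  have "\<sigma> \<noteq> {}" if "face_dim \<sigma> = j + 1" for \<sigma> :: "'v set"
    using that j by (auto simp: face_dim_def)
  then have chains: "chain_space (K - {{}}) (j + 1) = (chain_space K (j + 1) :: ('v set \<Rightarrow> 'f) set)"
    unfolding chain_space_def by blast
  have "chain_boundary (K - {{}}) c = chain_boundary K c"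
    if c: "c \<in> chain_space K (j + 1)" for c :: "'v set \<Rightarrow> 'f"
  proof -
    have "chain_boundary (K - {{}}) c = bd (vertices K) c"
      using W c j chains
      by (intro chain_boundary_bd[where j = "j + 1"]) (auto intro: complex_subset[OF K] simp: face_dim_def)
    then show ?thesis using complex_chain_boundary[OF K W c] by simp
  qed
  then show ?thesis unfolding boundary_space_def chains by (intro image_cong) auto
qed

lemma homology_class_eq_iff:
  fixes x y :: "'v set \<Rightarrow> 'f::field"
  assumes zero: "(0 :: 'v set \<Rightarrow> 'f) \<in> boundary_space K j"
    and diff: "\<And>a b :: 'v set \<Rightarrow> 'f. a \<in> boundary_space K j \<Longrightarrow> b \<in> boundary_space K j
      \<Longrightarrow> a - b \<in> boundary_space K j"
  shows "homology_class K j x = homology_class K j y \<longleftrightarrow> x - y \<in> boundary_space K j"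
proof
  assume "homology_class K j x = homology_class K j y"
  moreover have "x \<in> homology_class K j x" using zero by (force simp: homology_class_def)
  ultimately show "x - y \<in> boundary_space K j" by (auto simp: homology_class_def)
next
  assume xy: "x - y \<in> boundary_space K j"
  have sub: "homology_class K j x \<subseteq> homology_class K j y" if "x - y \<in> boundary_space K j"
    for x y :: "'v set \<Rightarrow> 'f"
  proof
    fix w assume "w \<in> homology_class K j x"
    then obtain b where b: "b \<in> boundary_space K j" "w = x + b" by (auto simp: homology_class_def)
    have "(x - y) - (0 - b) \<in> boundary_space K j" using diff that diff[OF zero b(1)] by blast
    moreover have "w = y + ((x - y) - (0 - b))" using b(2) by simp
    ultimately show "w \<in> homology_class K j y" unfolding homology_class_def by blast
  qed
  have "0 - (x - y) \<in> boundary_space K j" using diff[OF zero xy] .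
  then have "y - x \<in> boundary_space K j" by simp
  then show "homology_class K j x = homology_class K j y" using sub xy by blast
qed

text \<open>
  Injectivity on cosets amounts to the statement that a chain of \<open>K\<close> bounding in \<open>L\<close> bounds in \<open>K\<close>.
  The subspace properties are assumed, and not derived from properties of complexes, because \<open>K\<close> and \<open>L\<close> will be
  complexes deprived of the empty face.
\<close>

lemma homology_inclusion_inj_onI:
  fixes K L :: "'v set set"
  assumes zero: "(0 :: 'v set \<Rightarrow> 'f::field) \<in> boundary_space K j"
    and K: "\<And>a b :: 'v set \<Rightarrow> 'f. a \<in> boundary_space K j \<Longrightarrow> b \<in> boundary_space K j
      \<Longrightarrow> a - b \<in> boundary_space K j"
    and L: "\<And>a b :: 'v set \<Rightarrow> 'f. a \<in> boundary_space L j \<Longrightarrow> b \<in> boundary_space L j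
      \<Longrightarrow> a - b \<in> boundary_space L j"
    and KL: "(boundary_space K j :: ('v set \<Rightarrow> 'f) set) \<subseteq> boundary_space L j"
    and main: "\<And>z :: 'v set \<Rightarrow> 'f. z \<in> chain_space K j \<Longrightarrow> z \<in> boundary_space L j
      \<Longrightarrow> z \<in> boundary_space K j"
  shows "inj_on (homology_inclusion L j) (homology_space K j :: ('v set \<Rightarrow> 'f) set set)"
proof -
  have zero_L: "(0 :: 'v set \<Rightarrow> 'f) \<in> boundary_space L j" using zero KL by blast
  have incl: "homology_inclusion L j (homology_class K j x) = homology_class L j x"
    for x :: "'v set \<Rightarrow> 'f"
  proof -
    have "homology_class L j w = homology_class L j x" if "w \<in> homology_class K j x" for w
      using that KL homology_class_eq_iff[OF zero_L L, of w x] by (auto simp: homology_class_def)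
    moreover have "x \<in> homology_class K j x" using zero by (force simp: homology_class_def)
    ultimately have "homology_class L j ` homology_class K j x = {homology_class L j x}" by blast
    then show ?thesis by (simp add: homology_inclusion_def)
  qed
  show ?thesis
  proof (rule inj_onI)
    fix C D :: "('v set \<Rightarrow> 'f) set"
    assume "C \<in> homology_space K j" "D \<in> homology_space K j"
      and eq: "homology_inclusion L j C = homology_inclusion L j D"
    then obtain x y where C: "C = homology_class K j x" "x \<in> cycle_space K j"
      and D: "D = homology_class K j y" "y \<in> cycle_space K j"
      by (auto simp: homology_space_def)
    have "x - y \<in> boundary_space L j"
      using eq homology_class_eq_iff[OF zero_L L, of x y] unfolding C(1) D(1) incl by simp
    moreover have "x - y \<in> chain_space K j"
      using C(2) D(2) chain_space_diff by (auto simp: cycle_space_def)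
    ultimately have "x - y \<in> boundary_space K j" using main by blast
    then show "C = D" using homology_class_eq_iff[OF zero K, of x y] C D by simp
  qed
qed

theorem theorem14:
  fixes M :: "'v set set" and k d :: int
  assumes "0 < k"
    and "homology_manifold TYPE('f::field) d M"
    and "orientable TYPE('f) d M"
    and "neighbourly (k + 1) M"
    and "stacked TYPE('f) k d M"
    and "d \<noteq> 2 * k + 1"
  shows "tight TYPE('f) M"
proof -
  have MC: "simplicial_complex M" using assms(2) by (simp add: homology_manifold_def)
  note W = finite_vertices[OF MC] complex_Pow_vertices[of M]
  have conn: "connected_complex M" and iso: "homology_iso_field TYPE('f) (M - {{}}) d"
    using assms(3) by (auto simp: orientable_def)
  obtain X where X: "stacked_with_boundary TYPE('f) k d X" and MX: "M = manifold_boundary TYPE('f) X"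
    using assms(5) unfolding stacked_def by blast
  have XC: "simplicial_complex X" and Xpure: "pure_dim (d + 1) X" and kd: "1 \<le> k" "k \<le> d"
    and skel: "skel (d - k) X = skel (d - k) M"
    using X MX by (auto simp: stacked_with_boundary_def homology_manifold_with_boundary_def)
  have skeleton: "\<sigma> \<in> M" if "\<sigma> \<in> X" "face_dim \<sigma> \<le> d - k" for \<sigma>
    using that skel by (auto simp: skel_def)
  have M_sub: "M \<subseteq> X"
    using XC unfolding MX by (auto simp: manifold_boundary_def simplicial_complex_def)
  have acyclic: "trivial_reduced_homology TYPE('f) (link X \<alpha>)"
    if "\<alpha> \<in> X" "\<alpha> \<noteq> {}" "face_dim \<alpha> \<le> d - k" for \<alpha>
    using skeleton[OF that(1,3)] that(2) unfolding MX manifold_boundary_def by blast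
  have d1: "1 \<le> d" using kd by simp
  have top: "face_dim \<sigma> \<le> d" if "\<sigma> \<in> M" for \<sigma>
    using homology_manifold_face_dim[OF assms(2) that] .
  obtain y\<^sub>0 :: "'v set \<Rightarrow> 'f" where y\<^sub>0: "y\<^sub>0 \<in> cycle_space (M - {{}}) d" "y\<^sub>0 \<noteq> 0"
    using homology_line_generator[OF iso] top by (metis DiffD1 add_le_same_cancel1 not_one_le_zero)
  have "y\<^sub>0 \<in> cycle_space M d"
  proof -
    have "chain_boundary (M - {{}}) y\<^sub>0 = bd (vertices M) y\<^sub>0"
      using y\<^sub>0(1) W d1 by (intro chain_boundary_bd[where j = d])
        (auto intro: complex_subset[OF MC] simp: face_dim_def cycle_space_def)
    then show ?thesis
      using y\<^sub>0(1) cycle_space_bd[OF MC W, of y\<^sub>0 d] chain_space_mono[of "M - {{}}" M y\<^sub>0 d]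
      by (auto simp: cycle_space_def)
  qed
  note y\<^sub>0 = this y\<^sub>0(2)
  \<comment> \<open>A facet has \<open>d + 1 \<ge> k + 1\<close> vertices, so every smaller set of vertices extends to one with \<open>k + 1\<close> elements.\<close>
  have nb: "A \<in> M" if A: "A \<subseteq> vertices M" "int (card A) \<le> k + 1" for A
  proof (rule neighbourly_small_sets[OF MC assms(4) _ A])
    obtain \<sigma> where \<sigma>: "\<sigma> \<in> M" "y\<^sub>0 \<sigma> \<noteq> 0" "face_dim \<sigma> = d"
      using y\<^sub>0 by (auto simp: cycle_space_def chain_space_def fun_eq_iff)
    then have "card \<sigma> \<le> card (vertices M)" using W by (intro card_mono) auto
    then show "k + 1 \<le> int (card (vertices M))" using \<sigma>(3) kd by (simp add: face_dim_def)
  qed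
  \<comment> \<open>In nonnegative degrees a boundary has the same meaning with and without the empty face, so augmented chains can be used.\<close>
  have restrict: "z \<in> boundary_space (induced_subcomplex M A) j"
    if A: "A \<subseteq> vertices M" and j: "0 \<le> j" and z: "z \<in> chain_space (induced_subcomplex M A) j"
      "z \<in> boundary_space M j" for A j and z :: "'v set \<Rightarrow> 'f"
  proof -
    let ?N = "induced_subcomplex M A"
    have N: "simplicial_complex ?N" "?N \<subseteq> M"
      using complex_induced[OF MC] induced_subset by auto
    consider (all) "A = vertices M" | (low) "A \<noteq> vertices M" "j \<le> k - 1"
      | (high) "A \<noteq> vertices M" "d - k \<le> j" | (middle) "k \<le> j" "j \<le> d - k - 1" by linarith
    then show ?thesis
    proof cases
      case all
      then show ?thesis using z(2) induced_all[OF W(2)] by simp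
    next
      case low
      show ?thesis
      proof (cases "A = {}")
        case True
        then have "face_dim \<sigma> \<noteq> j" if "\<sigma> \<in> ?N" for \<sigma>
          using that j by (auto simp: induced_subcomplex_def face_dim_def)
        then have "z = 0" using z(1) chain_space_no_faces by blast
        then show ?thesis using boundary_space_zero[OF N(1)] by simp
      next
        case False
        have "z \<in> chain_space M j" using z(1) chain_space_mono N(2) by blast
        then have "bd (vertices M) z = 0"
          using boundary_is_cycle[OF MC _ z(2)] cycle_space_bd[OF MC W] by blast
        then have "z \<in> cycle_space ?N j"
          using z(1) cycle_space_bd[OF N(1) W(1)] N(2) W(2) by blast
        then show ?thesis
          using low A False by (intro low_degree_cycle_bounds[OF MC]) (auto intro!: nb)
      qed
    next
      case high
      then show ?thesis
        using boundary_restricts_high_degree_neighbourly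
          [OF assms(2) conn d1 y\<^sub>0 nb, where \<alpha> = "{}" and A = A and j = j and z = z] A z kd MC
        by (auto simp: link_empty simplicial_complex_def)
    next
      case middle
      let ?Y = "induced_subcomplex X A"
      have Y: "simplicial_complex ?Y" "?N \<subseteq> ?Y"
        using complex_induced[OF XC] M_sub by (auto simp: induced_subcomplex_def)
      have XW: "?Y \<subseteq> Pow (vertices X)" "?N \<subseteq> Pow (vertices X)"
        using complex_Pow_vertices[of X] induced_subset[of X A] Y(2) by blast+
      have "z \<in> boundary_space X j" using boundary_space_mono[OF XC MC M_sub z(2)] .
      moreover have "z \<in> chain_space ?Y j" using z(1) Y(2) chain_space_mono by blast
      ultimately have "z \<in> boundary_space ?Y j"
        using boundary_restricts_high_degree_stacked[where \<alpha> = "{}" and X = X and d = d and k = k]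
          XC acyclic pure_dim_bound[OF XC Xpure] middle kd
        by (auto simp: link_empty simplicial_complex_def face_dim_def)
      then obtain c where c: "c \<in> chain_space ?Y (j + 1)" "bd (vertices X) c = z"
        using boundary_space_bd[OF Y(1) finite_vertices[OF XC] XW(1)] by blast
      have "c \<in> chain_space ?N (j + 1)"
        using c(1) skeleton middle by (auto simp: chain_space_def induced_subcomplex_def)
      then show ?thesis
        using c(2) boundary_space_bd[OF N(1) finite_vertices[OF XC] XW(2)] by blast
    qed
  qed
  have "inj_on (homology_inclusion (M - {{}}) j)
      (homology_space (induced_subcomplex M A - {{}}) j :: ('v set \<Rightarrow> 'f) set set)"
    if A: "A \<subseteq> vertices M" for A j
  proof (cases "0 \<le> j")
    case True
    let ?N = "induced_subcomplex M A"
    have N: "simplicial_complex ?N" "?N \<subseteq> M"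
      using complex_induced[OF MC] induced_subset by auto
    have "?N \<subseteq> Pow (vertices M)" using N(2) W(2) by blast
    moreover have "z \<in> chain_space ?N j" if "z \<in> chain_space (?N - {{}}) j" for z :: "'v set \<Rightarrow> 'f"
      using that chain_space_mono[of "?N - {{}}" ?N] by blast
    ultimately show ?thesis
      using restrict[OF A True] boundary_space_diff[OF N(1) W(1)] boundary_space_diff[OF MC W]
        boundary_space_zero[OF N(1)] boundary_space_mono[OF MC N]
      by (intro homology_inclusion_inj_onI)
        (auto simp: boundary_space_unaugmented[OF N(1) True] boundary_space_unaugmented[OF MC True])
  next
    case False
    have "z = 0" if "z \<in> cycle_space (induced_subcomplex M A - {{}}) j" for z :: "'v set \<Rightarrow> 'f"
    proof (rule chain_space_no_faces)
      show "z \<in> chain_space (induced_subcomplex M A - {{}}) j" using that by (simp add: cycle_space_def)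
      show "face_dim \<sigma> \<noteq> j" if "\<sigma> \<in> induced_subcomplex M A - {{}}" for \<sigma>
        using that False complex_finite[OF MC, of \<sigma>] card_gt_0_iff[of \<sigma>]
        by (auto simp: face_dim_def induced_subcomplex_def)
    qed
    then have "C = homology_class (induced_subcomplex M A - {{}}) j 0"
      if "C \<in> homology_space (induced_subcomplex M A - {{}}) j" for C :: "('v set \<Rightarrow> 'f) set"
      using that unfolding homology_space_def by blast
    then show ?thesis by (metis inj_onI)
  qed
  then show ?thesis using conn unfolding tight_def by blast
qed

end
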